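(* Let $\gamma > 0$. The data $(U_-,W_-,X)$ are informative for $\mathcal{H}_2$ suboptimal control if and only if at least one of the following two conditions is satisfied: (i) There exists a $\Theta \in \mathbb{R}^{T \times n}$ such that $X_- \Theta = (X_-\Theta)^\top$, $$\begin{bmatrix} W_- \\ Z_- \end{bmatrix} \Theta = 0 \quad\text{and}\quad \begin{bmatrix} X_- \Theta & \Theta^\top X_+^\top \\ X_+ \Theta & X_-\Theta \end{bmatrix} > 0.$$ (ii) There exist a right inverse $W_-^\dagger$ of $W_-$, a matrix $Y = Y^\top$ (of size compatible with the inequalities below, i.e. $d\times d$) and $\Theta \in \mathbb{R}^{T \times n}$ such that $X_-\Theta$ is symmetric, the matrices $W_- \Theta$, $X_- W_-^\dagger$ and $U_- W_-^\dagger$ are zero, and $$\begin{bmatrix} X_-\Theta & \Theta^\top X_+^\top & \Theta^\top Z_-^\top \\ X_+ \Theta & X_-\Theta & 0 \\ Z_- \Theta & 0 & I \end{bmatrix} > 0, \qquad \begin{bmatrix} Y & (W_-^\dagger)^\top X_+^\top \\ X_+ W_-^\dagger & X_-\Theta \end{bmatrix} > 0, \qquad \operatorname{tr}(Y) < \gamma.$$ Moreover, a matrix $K\in\mathbb{R}^{m\times n}$ is an $\mathcal{H}_2$ suboptimal feedback gain for all $(A,B,E) \in \Sigma_{\mathrm{i/d/s}}$ if and only if $K = U_- \Theta (X_-\Theta)^{-1}$, where $\Theta$ satisfies the conditions of (i) or (ii).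
   Context: All matrices are real; $\operatorname{tr}$ denotes trace. For symmetric matrices, $M>0$ means positive definite. A square matrix is stable if all its eigenvalues lie in the open unit disk. A right inverse of a matrix $M$ is a matrix $M^\dagger$ with $MM^\dagger = I$. Data. There is a fixed system $x(t+1) = A_s x(t) + B_s u(t) + E_s w(t)$, $z(t) = Cx(t)+Du(t)$, with state $x\in\mathbb{R}^n$, input $u\in\mathbb{R}^m$, disturbance $w\in\mathbb{R}^d$, performance output $z\in\mathbb{R}^p$, where $A_s\in\mathbb{R}^{n\times n}$, $B_s\in\mathbb{R}^{n\times m}$, $E_s\in\mathbb{R}^{n\times d}$ are unknown and $C\in\mathbb{R}^{p\times n}$, $D\in\mathbb{R}^{p\times m}$ are known. From it one has measured $U_- = [u(0)\ \cdots\ u(T-1)]$, $W_- = [w(0)\ \cdots\ w(T-1)]$ and $X=[x(0)\ \cdots\ x(T)]$, and one sets $X_- = [x(0)\ \cdots\ x(T-1)]$, $X_+ = [x(1)\ \cdots\ x(T)]$ and $Z_- := CX_-+DU_-$. Thus $X_+ = A_sX_- + B_sU_- + E_sW_-$. The set of systems explaining the data is $$\Sigma_{\mathrm{i/d/s}} = \{(A,B,E)\in\mathbb{R}^{n\times n}\times\mathbb{R}^{n\times m}\times\mathbb{R}^{n\times d} \mid X_+ = AX_- + BU_- + EW_-\}.$$ Cost. For $(A,B,E)$ and $K\in\mathbb{R}^{m\times n}$ let $T_K(t) = (C+DK)(A+BK)^tE$ and $J_{\mathcal{H}_2}(K)=\sum_{t=0}^\infty \operatorname{tr}\left(T_K(t)^\top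 T_K(t)\right)$. Given $\gamma>0$, $K$ is an $\mathcal{H}_2$ suboptimal feedback gain (also called $\mathcal{H}_2$ suboptimal controller) for $(A,B,E)$ if $A+BK$ is stable and $J_{\mathcal{H}_2}(K)<\gamma$. Informativity. The data $(U_-,W_-,X)$ are informative for $\mathcal{H}_2$ suboptimal control (for given $\gamma$) if there exists a single matrix $K$ that is an $\mathcal{H}_2$ suboptimal feedback gain for all $(A,B,E)\in\Sigma_{\mathrm{i/d/s}}$. *)

theory Defs
  imports
    "Jordan_Normal_Form.Char_Poly"
    "Jordan_Normal_Form.Gauss_Jordan_Elimination"
begin

definition mat_trace :: "'a :: comm_monoid_add mat \<Rightarrow> 'a" where
  "mat_trace M = (\<Sum>i<dim_row M. M $$ (i, i))"

definition pos_def_mat :: "real mat \<Rightarrow> bool" where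
  "pos_def_mat M \<longleftrightarrow>
     square_mat M \<and> M\<^sup>T = M \<and>
     (\<forall>v \<in> carrier_vec (dim_row M). v \<noteq> 0\<^sub>v (dim_row M) \<longrightarrow> v \<bullet> (M *\<^sub>v v) > 0)"

(* The eigenvalues of a real matrix are its complex ones, hence the embedding. *)
definition stable_mat :: "real mat \<Rightarrow> bool" where
  "stable_mat M \<longleftrightarrow>
     square_mat M \<and> (\<forall>k. eigenvalue (map_mat complex_of_real M) k \<longrightarrow> cmod k < 1)"

definition right_inverse_mat :: "real mat \<Rightarrow> real mat \<Rightarrow> bool" where
  "right_inverse_mat M R \<longleftrightarrow> R \<in> carrier_mat (dim_col M) (dim_row M) \<and> inverts_mat M R"

definition three_block_mat ::
  "'a :: zero mat \<Rightarrow> 'a mat \<Rightarrow> 'a mat \<Rightarrow>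
   'a mat \<Rightarrow> 'a mat \<Rightarrow> 'a mat \<Rightarrow>
   'a mat \<Rightarrow> 'a mat \<Rightarrow> 'a mat \<Rightarrow> 'a mat" where
  "three_block_mat
      M11 M12 M13
      M21 M22 M23
      M31 M32 M33 =
     four_block_mat
       (four_block_mat M11 M12 M21 M22) (M13 @\<^sub>r M23)
       (M31\<^sup>T @\<^sub>r M32\<^sup>T)\<^sup>T M33"

text \<open>For \<open>X = [x(0) \<dots> x(T)]\<close>, these are \<open>X\<^sub>-\<close> and \<open>X\<^sub>+\<close>.\<close>

definition past_cols :: "'a mat \<Rightarrow> 'a mat" where
  "past_cols X = mat (dim_row X) (dim_col X - 1) (\<lambda>(i, j). X $$ (i, j))"

definition future_cols :: "'a mat \<Rightarrow> 'a mat" where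
  "future_cols X = mat (dim_row X) (dim_col X - 1) (\<lambda>(i, j). X $$ (i, Suc j))"

definition output_data :: "real mat \<Rightarrow> real mat \<Rightarrow> real mat \<Rightarrow> real mat \<Rightarrow> real mat" where
  "output_data C D U X = C * past_cols X + D * U"

definition explaining_systems ::
  "real mat \<Rightarrow> real mat \<Rightarrow> real mat \<Rightarrow> (real mat \<times> real mat \<times> real mat) set" where
  "explaining_systems U W X =
     {(A, B, E).
        A \<in> carrier_mat (dim_row X) (dim_row X) \<and>
        B \<in> carrier_mat (dim_row X) (dim_row U) \<and>
        E \<in> carrier_mat (dim_row X) (dim_row W) \<and>
        future_cols X = A * past_cols X + B * U + E * W}"

definition closed_loop_response ::
  "real mat \<Rightarrow> real mat \<Rightarrow> real mat \<Rightarrow> real mat \<Rightarrow> real mat \<Rightarrow> real mat \<Rightarrow> nat \<Rightarrow> real mat" where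
  "closed_loop_response C D A B E K t = (C + D * K) * (A + B * K) ^\<^sub>m t * E"

definition H2_cost ::
  "real mat \<Rightarrow> real mat \<Rightarrow> real mat \<Rightarrow> real mat \<Rightarrow> real mat \<Rightarrow> real mat \<Rightarrow> real" where
  "H2_cost C D A B E K =
     (\<Sum>t. mat_trace ((closed_loop_response C D A B E K t)\<^sup>T * closed_loop_response C D A B E K t))"

(* The series defining the cost converges whenever A + B K is stable, so the
   junk value of a divergent sum plays no role here. *)
definition H2_suboptimal_gain ::
  "real \<Rightarrow> real mat \<Rightarrow> real mat \<Rightarrow> real mat \<Rightarrow> real mat \<Rightarrow> real mat \<Rightarrow> real mat \<Rightarrow> bool" where
  "H2_suboptimal_gain \<gamma> C D A B E K \<longleftrightarrow>
     K \<in> carrier_mat (dim_col B) (dim_row A) \<and>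
     stable_mat (A + B * K) \<and> H2_cost C D A B E K < \<gamma>"

definition H2_suboptimal_for_data ::
  "real \<Rightarrow> real mat \<Rightarrow> real mat \<Rightarrow> real mat \<Rightarrow> real mat \<Rightarrow> real mat \<Rightarrow> real mat \<Rightarrow> bool" where
  "H2_suboptimal_for_data \<gamma> C D U W X K \<longleftrightarrow>
     (\<forall>(A, B, E) \<in> explaining_systems U W X. H2_suboptimal_gain \<gamma> C D A B E K)"

definition informative_H2 ::
  "real \<Rightarrow> real mat \<Rightarrow> real mat \<Rightarrow> real mat \<Rightarrow> real mat \<Rightarrow> real mat \<Rightarrow> bool" where
  "informative_H2 \<gamma> C D U W X \<longleftrightarrow>
     (\<exists>K \<in> carrier_mat (dim_row U) (dim_row X). H2_suboptimal_for_data \<gamma> C D U W X K)"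

definition cond_i ::
  "real mat \<Rightarrow> real mat \<Rightarrow> real mat \<Rightarrow> real mat \<Rightarrow> real mat \<Rightarrow> real mat \<Rightarrow> bool" where
  "cond_i C D U W X \<Theta> \<longleftrightarrow>
     (let Xm = past_cols X; Xp = future_cols X; Z = output_data C D U X;
          n = dim_row X; d = dim_row W; p = dim_row C in
        \<Theta> \<in> carrier_mat (dim_col Xm) n \<and>
        Xm * \<Theta> = (Xm * \<Theta>)\<^sup>T \<and>
        (W @\<^sub>r Z) * \<Theta> = 0\<^sub>m (d + p) n \<and>
        pos_def_mat (four_block_mat
          (Xm * \<Theta>) (\<Theta>\<^sup>T * Xp\<^sup>T)
          (Xp * \<Theta>) (Xm * \<Theta>)))"

definition cond_ii ::
  "real \<Rightarrow> real mat \<Rightarrow> real mat \<Rightarrow> real mat \<Rightarrow> real mat \<Rightarrow> real mat \<Rightarrow>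
   real mat \<Rightarrow> real mat \<Rightarrow> real mat \<Rightarrow> bool" where
  "cond_ii \<gamma> C D U W X Wi Y \<Theta> \<longleftrightarrow>
     (let Xm = past_cols X; Xp = future_cols X; Z = output_data C D U X;
          n = dim_row X; m = dim_row U; d = dim_row W; p = dim_row C in
        right_inverse_mat W Wi \<and>
        Y \<in> carrier_mat d d \<and> Y = Y\<^sup>T \<and>
        \<Theta> \<in> carrier_mat (dim_col Xm) n \<and>
        Xm * \<Theta> = (Xm * \<Theta>)\<^sup>T \<and>
        W * \<Theta> = 0\<^sub>m d n \<and> Xm * Wi = 0\<^sub>m n d \<and> U * Wi = 0\<^sub>m m d \<and>
        pos_def_mat (three_block_mat
          (Xm * \<Theta>) (\<Theta>\<^sup>T * Xp\<^sup>T) (\<Theta>\<^sup>T * Z\<^sup>T)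
          (Xp * \<Theta>) (Xm * \<Theta>)   (0\<^sub>m n p)
          (Z * \<Theta>)  (0\<^sub>m p n)    (1\<^sub>m p)) \<and>
        pos_def_mat (four_block_mat
          Y         (Wi\<^sup>T * Xp\<^sup>T)
          (Xp * Wi) (Xm * \<Theta>)) \<and>
        mat_trace Y < \<gamma>)"

(* Meaningful when the square matrix past_cols X * \<Theta> is invertible, as cond_i and cond_ii
   ensure through positive definiteness; mat_inverse is then Some of the inverse. *)
definition data_gain :: "real mat \<Rightarrow> real mat \<Rightarrow> real mat \<Rightarrow> real mat" where
  "data_gain U X \<Theta> = U * \<Theta> * the (mat_inverse (past_cols X * \<Theta>))"

end

theory Submission
  imports Defs "Jordan_Normal_Form.Spectral_Radius"
begin

text \<open>
  Let \<open>K\<close> be suboptimal for all explaining systems. These form an affine space whose directions are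
  the triples \<open>g (\<xi>, \<eta>, \<zeta>)\<^sup>T\<close> with \<open>(\<xi>, \<eta>, \<zeta>)\<close> in the left kernel of the stacked data. Along such a
  direction with \<open>g = \<xi> + K\<^sup>T \<eta>\<close> the trace of the closed loop grows with slope \<open>g \<bullet> g\<close>, while the trace of a
  stable matrix is bounded by its size; hence \<open>\<xi> + K\<^sup>T \<eta> = 0\<close>. Dually, some \<open>\<Psi>\<close> satisfies \<open>X\<^sub>- \<Psi> = I\<close>,
  \<open>U \<Psi> = K\<close>, \<open>W \<Psi> = 0\<close>, so that \<open>F = X\<^sub>+ \<Psi>\<close> and \<open>G = Z \<Psi>\<close> are the closed loop and output matrices
  of every explaining system. If \<open>G = 0\<close>, a Lyapunov function of \<open>F\<close> gives condition (i). Otherwise the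
  output at time 0 can stay bounded along all directions only if \<open>\<zeta> = 0\<close>, which dually gives the right
  inverse of \<open>W\<close> and makes \<open>E\<close> unique; a slightly enlarged observability Gramian \<open>R\<close> then gives
  condition (ii) with \<open>\<Theta> = \<Psi> R\<^sup>-\<^sup>1\<close>. The converse reads the Lyapunov inequalities for
  \<open>R = (X\<^sub>- \<Theta>)\<^sup>-\<^sup>1\<close> off the Schur complements.
\<close>

subsection \<open>Traces and powers of stable matrices\<close>

lemma mat_trace_mult_comm:
  fixes A B :: "'a :: comm_semiring_0 mat"
  assumes "A \<in> carrier_mat n k" "B \<in> carrier_mat k n"
  shows "mat_trace (A * B) = mat_trace (B * A)"
proof -
  have "mat_trace (A * B) = (\<Sum>i<n. \<Sum>j<k. A $$ (i,j) * B $$ (j,i))"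
    using assms by (auto simp: mat_trace_def scalar_prod_def lessThan_atLeast0 intro!: sum.cong)
  also have "\<dots> = (\<Sum>j<k. \<Sum>i<n. B $$ (j,i) * A $$ (i,j))"
    by (subst sum.swap) (simp add: mult.commute)
  also have "\<dots> = mat_trace (B * A)"
    using assms by (auto simp: mat_trace_def scalar_prod_def lessThan_atLeast0 intro!: sum.cong)
  finally show ?thesis .
qed

text \<open>The trace is invariant under similarity, so it equals that of a Schur triangular form,
  whose diagonal lists the \<open>n\<close> roots of the characteristic polynomial with
  multiplicity.\<close>

lemma norm_trace_le_of_eigenvalues:
  fixes A :: "complex mat"
  assumes A: "A \<in> carrier_mat n n" and ev: "\<And>k. eigenvalue A k \<Longrightarrow> norm k \<le> 1"
  shows "norm (mat_trace A) \<le> n"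
proof -
  obtain es where cp: "char_poly A = (\<Prod>a\<leftarrow>es. [:- a, 1:])" and len: "length es = n"
    using char_poly_factorized[OF A] by auto
  obtain B P Q where "schur_decomposition A es = (B, P, Q)"
    by (cases "schur_decomposition A es") auto
  from schur_decomposition[OF A cp this]
  have sim: "similar_mat_wit A B P Q" and diag: "diag_mat B = es" by auto
  note w = similar_mat_witD2[OF A sim]
  have "mat_trace A = mat_trace (P * (B * Q))" using w by (metis assoc_mult_mat)
  also have "\<dots> = mat_trace (B * Q * P)"
    using w by (intro mat_trace_mult_comm) auto
  also have "B * Q * P = B" using w by (metis assoc_mult_mat right_mult_one_mat)
  also have "mat_trace B = (\<Sum>i<n. es ! i)"
    using w(5) diag[symmetric] by (auto simp: mat_trace_def diag_mat_def)
  finally have "norm (mat_trace A) \<le> (\<Sum>i<n. norm (es ! i))" by (simp add: norm_sum)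
  also have "\<dots> \<le> (\<Sum>i<n. 1)"
  proof (rule sum_mono)
    fix i assume "i \<in> {..<n}"
    hence "es ! i \<in> set es" using len by auto
    hence "poly (char_poly A) (es ! i) = 0" unfolding cp by (rule linear_poly_root)
    thus "norm (es ! i) \<le> 1" using ev eigenvalue_root_char_poly[OF A] by auto
  qed
  finally show ?thesis by simp
qed

text \<open>Bounded trace is the only consequence of stability used against perturbations: a line of
  closed loops along which the trace varies must leave the stable set.\<close>

lemma abs_trace_stable_le:
  assumes "M \<in> carrier_mat n n" "stable_mat M"
  shows "\<bar>mat_trace M\<bar> \<le> n"
proof -
  have "mat_trace (map_mat complex_of_real M) = complex_of_real (mat_trace M)"
    using assms by (auto simp: mat_trace_def)
  moreover have "norm (mat_trace (map_mat complex_of_real M)) \<le> n"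
    using assms by (intro norm_trace_le_of_eigenvalues) (auto simp: stable_mat_def intro: less_imp_le)
  ultimately show ?thesis by (simp del: of_real_sum)
qed

lemma smult_pow_mat:
  fixes A :: "'a :: comm_ring_1 mat"
  assumes A: "A \<in> carrier_mat n n"
  shows "(c \<cdot>\<^sub>m A) ^\<^sub>m k = c ^ k \<cdot>\<^sub>m A ^\<^sub>m k"
proof (induction k)
  case 0
  show ?case using A by (intro eq_matI) auto
next
  case (Suc k)
  have "A ^\<^sub>m k \<in> carrier_mat n n" using A by simp
  thus ?case using A Suc
    by (intro eq_matI) (auto simp: mult.assoc mult_smult_distrib[of _ n n] mult_smult_assoc_mat[of _ n n])
qed

lemma map_mat_of_real_pow:
  fixes A :: "real mat"
  assumes A: "A \<in> carrier_mat n n"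
  shows "map_mat complex_of_real (A ^\<^sub>m k) = map_mat complex_of_real A ^\<^sub>m k"
  by (rule of_real_hom.mat_hom_pow[OF A])

text \<open>Dividing by a number \<open>r\<close> strictly between the spectral radius and 1 leaves
  a matrix of spectral radius below 1, whose powers are bounded via its Jordan form; undoing the
  scaling gives the factor \<open>r ^ t\<close>.\<close>

lemma stable_mat_pow_geometric:
  assumes M: "M \<in> carrier_mat n n" and st: "stable_mat M"
  obtains c r where "0 < r" "r < 1" "\<And>t i j. i < n \<Longrightarrow> j < n \<Longrightarrow> \<bar>(M ^\<^sub>m t) $$ (i,j)\<bar> \<le> c * r ^ t"
\<comment> \<open>For \<open>n = 0\<close> there are no eigenvalues, so the spectral radius is not a
  maximum over a nonempty set; the claim on entries is then vacuous.\<close>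
proof (cases "n = 0")
  case True
  thus ?thesis using that[of "1/2" 0] by auto
next
  case False
  let ?M = "map_mat complex_of_real M"
  have M': "?M \<in> carrier_mat n n" using M by auto
  define s where "s = spectral_radius ?M"
  have "s \<in> norm ` spectrum ?M" unfolding s_def using spectral_radius_mem_max(1)[OF M'] False by auto
  then obtain k where k: "eigenvalue ?M k" "s = norm k" by (auto simp: spectrum_def)
  hence s: "0 \<le> s" "s < 1" using st by (auto simp: stable_mat_def)
  then obtain r where r: "s < r" "r < 1" using dense by blast
  hence r0: "r > 0" using s by simp
  let ?N = "complex_of_real (1/r) \<cdot>\<^sub>m ?M"
  have N: "?N \<in> carrier_mat n n" using M' by auto
  have "spectral_radius ?N \<in> norm ` spectrum ?N"
    using spectral_radius_mem_max(1)[OF N] False by auto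
  then obtain l where l: "eigenvalue ?N l" "spectral_radius ?N = norm l" by (auto simp: spectrum_def)
  then obtain v where v: "v \<in> carrier_vec n" "v \<noteq> 0\<^sub>v n" "?N *\<^sub>v v = l \<cdot>\<^sub>v v"
    using M by (auto simp: eigenvalue_def eigenvector_def)
  \<comment> \<open>An eigenvalue \<open>l\<close> of the scaled matrix yields the eigenvalue
    \<open>r * l\<close> of \<open>?M\<close>, hence \<open>r * norm l \<le> s < r\<close>.\<close>
  have "?M *\<^sub>v v = (r * l) \<cdot>\<^sub>v v"
  proof -
    have "?M *\<^sub>v v = complex_of_real r \<cdot>\<^sub>v (?N *\<^sub>v v)"
      using r0 v(1) M' by (intro eq_vecI) auto
    thus ?thesis unfolding v by (simp add: smult_smult_assoc)
  qed
  hence "eigenvalue ?M (r * l)" using v M unfolding eigenvalue_def eigenvector_def by auto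
  hence "r * l \<in> spectrum ?M" by (auto simp: spectrum_def)
  hence "norm (r * l) \<le> s" unfolding s_def using spectral_radius_mem_max(2)[OF M'] False by auto
  hence "r * norm l \<le> s" using r0 by (simp add: norm_mult)
  hence "r * norm l < r * 1" using r by linarith
  hence "spectral_radius ?N < 1" using r0 l by (simp only: mult_less_cancel_left_pos)
  from spectral_radius_jnf_norm_bound_less_1_upper_triangular[OF N this]
  obtain c where c: "\<And>k. norm_bound (?N ^\<^sub>m k) c" by auto
  show ?thesis
  proof (rule that[OF r0 r(2), of c])
    fix t i j assume ij: "i < n" "j < n"
    have Mt: "M ^\<^sub>m t \<in> carrier_mat n n" using M by simp
    have "norm ((?N ^\<^sub>m t) $$ (i,j)) \<le> c" using c[of t] ij unfolding norm_bound_def carrier_matD[OF pow_carrier_mat[OF N]] by blast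
    also have "(?N ^\<^sub>m t) $$ (i,j) = complex_of_real ((1/r)^t * (M ^\<^sub>m t) $$ (i,j))"
      using ij Mt M unfolding smult_pow_mat[OF M'] map_mat_of_real_pow[OF M, symmetric] by auto
    finally show "\<bar>(M ^\<^sub>m t) $$ (i,j)\<bar> \<le> c * r ^ t"
      using r0 by (simp add: abs_mult field_simps norm_mult norm_power norm_divide)
  qed
qed

subsection \<open>Solvability of linear systems\<close>

lemma affine_bounded_imp_zero:
  fixes a b c :: real
  assumes "\<And>s. \<bar>a + s * b\<bar> \<le> c"
  shows "b = 0"
proof (rule ccontr)
  assume "b \<noteq> 0"
  \<comment> \<open>At this value of \<open>s\<close> the affine function equals
    \<open>\<bar>c\<bar> + 1\<close>, which exceeds \<open>c\<close>.\<close>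
  thus False using assms[of "(\<bar>c\<bar> + 1 - a) / b"] by simp
qed

text \<open>Gram-Schmidt on the columns of \<open>M\<close>, one column at a time: the combination
  \<open>x\<close> of the columns is the projection of \<open>b\<close> onto their span and
  \<open>e\<close> is the residual.\<close>

lemma orthogonal_decomposition:
  fixes M :: "nat \<Rightarrow> nat \<Rightarrow> real"
  shows "\<exists>x e. (\<forall>i<r. b i = (\<Sum>j<k. M i j * x j) + e i) \<and> (\<forall>j<k. (\<Sum>i<r. e i * M i j) = 0)"
proof (induction k arbitrary: b)
  case 0
  show ?case by auto
next
  case (Suc k)
  obtain x e where x: "\<And>i. i < r \<Longrightarrow> b i = (\<Sum>j<k. M i j * x j) + e i"
    and e: "\<And>j. j < k \<Longrightarrow> (\<Sum>i<r. e i * M i j) = 0" using Suc by metis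
  obtain y f where y: "\<And>i. i < r \<Longrightarrow> M i k = (\<Sum>j<k. M i j * y j) + f i"
    and f: "\<And>j. j < k \<Longrightarrow> (\<Sum>i<r. f i * M i j) = 0" using Suc[of "\<lambda>i. M i k"] by metis
  \<comment> \<open>A vector orthogonal to the first \<open>k\<close> columns sees column
    \<open>k\<close> only through its residual \<open>f\<close>.\<close>
  have ortho: "(\<Sum>i<r. g i * M i k) = (\<Sum>i<r. g i * f i)" if "\<And>j. j < k \<Longrightarrow> (\<Sum>i<r. g i * M i j) = 0" for g
  proof -
    have "(\<Sum>i<r. g i * M i k) = (\<Sum>i<r. (\<Sum>j<k. g i * M i j * y j) + g i * f i)"
      by (intro sum.cong) (auto simp: y algebra_simps sum_distrib_left)
    also have "\<dots> = (\<Sum>j<k. \<Sum>i<r. g i * M i j * y j) + (\<Sum>i<r. g i * f i)"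
      by (subst sum.distrib, subst sum.swap) auto
    also have "(\<Sum>j<k. \<Sum>i<r. g i * M i j * y j) = 0"
      by (rule sum.neutral) (auto simp: sum_distrib_right[symmetric] that)
    finally show ?thesis by simp
  qed
  \<comment> \<open>\<open>c\<close> is the coefficient of the projection of \<open>e\<close> onto
    \<open>f\<close>. If \<open>f\<close> vanishes on the index range, division by zero gives
    \<open>c = 0\<close>, and the equation below holds with both sides zero.\<close>
  define c where "c = (\<Sum>i<r. e i * f i) / (\<Sum>i<r. f i * f i)"
  have c: "(\<Sum>i<r. e i * f i) = c * (\<Sum>i<r. f i * f i)"
  proof (cases "(\<Sum>i<r. f i * f i) = 0")
    case True
    hence "\<forall>i<r. f i * f i = 0" by (subst (asm) sum_nonneg_eq_0_iff) auto
    hence "(\<Sum>i<r. e i * f i) = 0" by (intro sum.neutral) auto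
    thus ?thesis using True by simp
  qed (simp add: c_def)
  \<comment> \<open>As \<open>f\<close> is column \<open>k\<close> minus the combination
    \<open>y\<close> of the earlier columns, moving \<open>c f\<close> from the residual into the
    span changes coefficient \<open>j\<close> by \<open>- c * y j\<close> and gives column
    \<open>k\<close> the coefficient \<open>c\<close>.\<close>
  let ?e = "\<lambda>i. e i - c * f i" and ?x = "\<lambda>j. if j = k then c else x j - c * y j"
  have e': "(\<Sum>i<r. ?e i * M i j) = 0" if "j < k" for j
    using e[OF that] f[OF that] by (simp add: algebra_simps sum_subtractf sum_distrib_left[symmetric])
  have "(\<Sum>i<r. ?e i * M i k) = (\<Sum>i<r. ?e i * f i)"
    by (rule ortho[OF e'])
  also have "\<dots> = 0"
    using c by (simp add: left_diff_distrib sum_subtractf sum_distrib_left[symmetric] mult.assoc)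
  finally have "(\<Sum>i<r. ?e i * M i k) = 0" .
  moreover have "b i = (\<Sum>j<Suc k. M i j * ?x j) + ?e i" if "i < r" for i
    using x[OF that] y[OF that] by (simp add: algebra_simps sum_subtractf sum_distrib_left)
  ultimately show ?case using e' by (intro exI[of _ ?x] exI[of _ ?e]) (auto simp: less_Suc_eq)
qed

text \<open>Fredholm alternative, column by column: the residual \<open>e\<close> of a column of
  \<open>B\<close> lies in the left kernel of \<open>M\<close>, hence is orthogonal to that column
  by \<open>ker\<close>; expanding the product leaves \<open>e \<bullet> e = 0\<close>.\<close>

lemma solvable_if_left_kernel_annihilates:
  fixes M B :: "real mat"
  assumes M: "M \<in> carrier_mat r k" and B: "B \<in> carrier_mat r q"
    and ker: "\<And>v. v \<in> carrier_vec r \<Longrightarrow> M\<^sup>T *\<^sub>v v = 0\<^sub>v k \<Longrightarrow> B\<^sup>T *\<^sub>v v = 0\<^sub>v q"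
  obtains \<Theta> where "\<Theta> \<in> carrier_mat k q" "M * \<Theta> = B"
proof -
  have "\<exists>x. \<forall>i<r. B $$ (i,l) = (\<Sum>j<k. M $$ (i,j) * x j)" if l: "l < q" for l
  proof -
    from orthogonal_decomposition[where b = "\<lambda>i. B $$ (i,l)" and M = "\<lambda>i j. M $$ (i,j)"]
    obtain x e where "\<forall>i<r. B $$ (i,l) = (\<Sum>j<k. M $$ (i,j) * x j) + e i"
      and "\<forall>j<k. (\<Sum>i<r. e i * M $$ (i,j)) = 0" by blast
    hence x: "\<And>i. i < r \<Longrightarrow> B $$ (i,l) = (\<Sum>j<k. M $$ (i,j) * x j) + e i"
      and e: "\<And>j. j < k \<Longrightarrow> (\<Sum>i<r. e i * M $$ (i,j)) = 0" by auto
    have "M\<^sup>T *\<^sub>v vec r e = 0\<^sub>v k"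
      using M e by (intro eq_vecI) (auto simp: scalar_prod_def lessThan_atLeast0 mult.commute)
    hence "B\<^sup>T *\<^sub>v vec r e = 0\<^sub>v q" by (intro ker) auto
    hence "(B\<^sup>T *\<^sub>v vec r e) $ l = 0" using l by simp
    hence "0 = (\<Sum>i<r. B $$ (i,l) * e i)"
      using B l by (simp add: scalar_prod_def lessThan_atLeast0)
    also have "\<dots> = (\<Sum>i<r. (\<Sum>j<k. e i * M $$ (i,j) * x j) + e i * e i)"
      by (intro sum.cong) (auto simp: x algebra_simps sum_distrib_left)
    also have "\<dots> = (\<Sum>j<k. \<Sum>i<r. e i * M $$ (i,j) * x j) + (\<Sum>i<r. e i * e i)"
      by (subst sum.distrib, subst sum.swap) auto
    also have "(\<Sum>j<k. \<Sum>i<r. e i * M $$ (i,j) * x j) = 0"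
      by (rule sum.neutral) (auto simp: sum_distrib_right[symmetric] e)
    finally have "(\<Sum>i<r. e i * e i) = 0" by simp
    hence "\<forall>i<r. e i * e i = 0" by (subst (asm) sum_nonneg_eq_0_iff) auto
    thus ?thesis using x by (intro exI[of _ x]) auto
  qed
  hence "\<forall>l\<in>{..<q}. \<exists>x. \<forall>i<r. B $$ (i,l) = (\<Sum>j<k. M $$ (i,j) * x j)" by blast
  from bchoice[OF this] obtain x where
    x: "\<And>l i. l < q \<Longrightarrow> i < r \<Longrightarrow> B $$ (i,l) = (\<Sum>j<k. M $$ (i,j) * x l j)" by auto
  show ?thesis
  proof (rule that[of "mat k q (\<lambda>(j,l). x l j)"])
    show "M * mat k q (\<lambda>(j,l). x l j) = B"
      using M B x by (intro eq_matI) (auto simp: scalar_prod_def lessThan_atLeast0)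
  qed auto
qed

text \<open>Stacking the blocks reduces this to a single system. It serves to prescribe the products
  of \<open>Xm\<close>, \<open>U\<close> and \<open>W\<close> with one unknown matrix
  simultaneously.\<close>

lemma solvable_if_left_kernel_annihilates3:
  fixes M1 M2 M3 B1 B2 B3 :: "real mat"
  assumes M: "M1 \<in> carrier_mat r1 k" "M2 \<in> carrier_mat r2 k" "M3 \<in> carrier_mat r3 k"
    and B: "B1 \<in> carrier_mat r1 q" "B2 \<in> carrier_mat r2 q" "B3 \<in> carrier_mat r3 q"
    and ker: "\<And>v1 v2 v3. v1 \<in> carrier_vec r1 \<Longrightarrow> v2 \<in> carrier_vec r2 \<Longrightarrow> v3 \<in> carrier_vec r3 \<Longrightarrow>
      M1\<^sup>T *\<^sub>v v1 + M2\<^sup>T *\<^sub>v v2 + M3\<^sup>T *\<^sub>v v3 = 0\<^sub>v k \<Longrightarrow> B1\<^sup>T *\<^sub>v v1 + B2\<^sup>T *\<^sub>v v2 + B3\<^sup>T *\<^sub>v v3 = 0\<^sub>v q"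
  obtains \<Theta> where "\<Theta> \<in> carrier_mat k q" "M1 * \<Theta> = B1" "M2 * \<Theta> = B2" "M3 * \<Theta> = B3"
proof -
  let ?st = "\<lambda>c (P1 :: real mat) P2 P3. mat (r1 + (r2 + r3)) c (\<lambda>(i,j). if i < r1 then P1 $$ (i,j) else
    if i < r1 + r2 then P2 $$ (i - r1, j) else P3 $$ (i - (r1 + r2), j))"
  have sum3: "(\<Sum>i<r1 + (r2 + r3). f i) = (\<Sum>i<r1. f i) + (\<Sum>i<r2. f (r1 + i)) + (\<Sum>i<r3. f (r1 + r2 + i))"
    for f :: "nat \<Rightarrow> real"
  proof -
    have aux: "(\<Sum>i<a + b. g i) = (\<Sum>i<a. g i) + (\<Sum>i<b. g (a + i))" for a b and g :: "nat \<Rightarrow> real"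
      by (induction b) auto
    show ?thesis unfolding aux by (simp add: add.assoc)
  qed
  have tr: "(?st c P1 P2 P3)\<^sup>T *\<^sub>v v = P1\<^sup>T *\<^sub>v vec r1 (\<lambda>i. v $ i) + P2\<^sup>T *\<^sub>v vec r2 (\<lambda>i. v $ (r1 + i))
      + P3\<^sup>T *\<^sub>v vec r3 (\<lambda>i. v $ (r1 + r2 + i))"
    if "P1 \<in> carrier_mat r1 c" "P2 \<in> carrier_mat r2 c" "P3 \<in> carrier_mat r3 c" "v \<in> carrier_vec (r1 + (r2 + r3))"
    for c P1 P2 P3 v
    using that by (intro eq_vecI) (auto simp: scalar_prod_def lessThan_atLeast0[symmetric] sum3)
  obtain \<Theta> where T: "\<Theta> \<in> carrier_mat k q" "?st k M1 M2 M3 * \<Theta> = ?st q B1 B2 B3"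
  proof (rule solvable_if_left_kernel_annihilates[of "?st k M1 M2 M3" "r1 + (r2 + r3)" k "?st q B1 B2 B3" q])
    fix v assume v: "v \<in> carrier_vec (r1 + (r2 + r3))" and "(?st k M1 M2 M3)\<^sup>T *\<^sub>v v = 0\<^sub>v k"
    thus "(?st q B1 B2 B3)\<^sup>T *\<^sub>v v = 0\<^sub>v q" unfolding tr[OF M v] tr[OF B v] by (intro ker) auto
  qed auto
  have eq: "(?st k M1 M2 M3 * \<Theta>) $$ (i,j) = ?st q B1 B2 B3 $$ (i,j)" for i j unfolding T ..
  show ?thesis
  proof (rule that[OF T(1)])
    show "M1 * \<Theta> = B1"
    proof (rule eq_matI)
      fix i j assume "i < dim_row B1" "j < dim_col B1"
      thus "(M1 * \<Theta>) $$ (i,j) = B1 $$ (i,j)" using eq[of i j] M B T(1) by (auto simp: scalar_prod_def)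
    qed (use M B T in auto)
    show "M2 * \<Theta> = B2"
    proof (rule eq_matI)
      fix i j assume "i < dim_row B2" "j < dim_col B2"
      thus "(M2 * \<Theta>) $$ (i,j) = B2 $$ (i,j)" using eq[of "r1 + i" j] M B T(1) by (auto simp: scalar_prod_def)
    qed (use M B T in auto)
    show "M3 * \<Theta> = B3"
    proof (rule eq_matI)
      fix i j assume "i < dim_row B3" "j < dim_col B3"
      thus "(M3 * \<Theta>) $$ (i,j) = B3 $$ (i,j)" using eq[of "r1 + r2 + i" j] M B T(1) by (auto simp: scalar_prod_def)
    qed (use M B T in auto)
  qed
qed

subsection \<open>Positive definite block matrices\<close>

lemma mult_mat_vec_zero:
  fixes A :: "'a :: semiring_0 mat"
  shows "A \<in> carrier_mat r c \<Longrightarrow> A *\<^sub>v 0\<^sub>v c = 0\<^sub>v r"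
  by (intro eq_vecI) auto

lemma sym_mat_adjoint:
  fixes D :: "real mat"
  assumes "D \<in> carrier_mat n n" "D\<^sup>T = D" "x \<in> carrier_vec n" "y \<in> carrier_vec n"
  shows "(D *\<^sub>v x) \<bullet> y = x \<bullet> (D *\<^sub>v y)"
  using transpose_vec_mult_scalar[of D n n y x] assms by simp

lemma scalar_prod_self_pos:
  fixes x :: "real vec"
  assumes "x \<in> carrier_vec n" "x \<noteq> 0\<^sub>v n"
  shows "x \<bullet> x > 0"
proof -
  obtain i where "i < n" "x $ i \<noteq> 0" using assms by (metis carrier_vecD eq_vecI index_zero_vec)
  hence "(\<Sum>i<n. x $ i * x $ i) > 0" by (intro sum_pos2[of _ i]) (auto simp: not_square_less_zero linorder_neq_iff mult_neg_neg)
  thus ?thesis using assms by (simp add: scalar_prod_def lessThan_atLeast0)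
qed

lemma pos_def_matD:
  assumes "pos_def_mat D" "D \<in> carrier_mat n n"
  shows "D\<^sup>T = D" "\<And>v. v \<in> carrier_vec n \<Longrightarrow> v \<noteq> 0\<^sub>v n \<Longrightarrow> v \<bullet> (D *\<^sub>v v) > 0"
    "\<And>v. v \<in> carrier_vec n \<Longrightarrow> v \<bullet> (D *\<^sub>v v) \<ge> 0"
proof -
  show "D\<^sup>T = D" and *: "\<And>v. v \<in> carrier_vec n \<Longrightarrow> v \<noteq> 0\<^sub>v n \<Longrightarrow> v \<bullet> (D *\<^sub>v v) > 0"
    using assms by (auto simp: pos_def_mat_def)
  show "v \<bullet> (D *\<^sub>v v) \<ge> 0" if "v \<in> carrier_vec n" for v
    using *[OF that] that assms(2) by (cases "v = 0\<^sub>v n") (auto intro: less_imp_le)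
qed

lemma pos_def_matI:
  assumes "D \<in> carrier_mat n n" "D\<^sup>T = D"
    "\<And>v. v \<in> carrier_vec n \<Longrightarrow> v \<noteq> 0\<^sub>v n \<Longrightarrow> v \<bullet> (D *\<^sub>v v) > 0"
  shows "pos_def_mat D"
  using assms by (auto simp: pos_def_mat_def square_mat.simps)

lemma pos_def_one: "pos_def_mat (1\<^sub>m n)"
  by (rule pos_def_matI[of _ n]) (auto intro: scalar_prod_self_pos)

text \<open>A kernel vector would contradict definiteness, so the determinant is nonzero and
  \<open>mat_inverse\<close> returns a value. Definiteness passes to the inverse because
  \<open>v \<bullet> R v\<close> is the form of \<open>Q\<close> at \<open>R v\<close>.\<close>

lemma pos_def_inverse:
  assumes pd: "pos_def_mat Q" and Q: "Q \<in> carrier_mat n n"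
  obtains R where "mat_inverse Q = Some R" "R \<in> carrier_mat n n" "Q * R = 1\<^sub>m n" "R * Q = 1\<^sub>m n" "pos_def_mat R"
proof -
  note Qp = pos_def_matD[OF pd Q]
  have "det Q \<noteq> 0"
  proof
    assume "det Q = 0"
    then obtain v where v: "v \<in> carrier_vec n" "v \<noteq> 0\<^sub>v n" "Q *\<^sub>v v = 0\<^sub>v n"
      using det_0_iff_vec_prod_zero_field[OF Q] by auto
    thus False using Qp(2)[OF v(1,2)] by simp
  qed
  hence "Q \<in> Units (ring_mat TYPE(real) n ())" by (rule det_non_zero_imp_unit[OF Q])
  then obtain R where inv: "mat_inverse Q = Some R" using mat_inverse(1)[OF Q, of "()"] by (cases "mat_inverse Q") auto
  from mat_inverse(2)[OF Q inv] have R: "Q * R = 1\<^sub>m n" "R * Q = 1\<^sub>m n" "R \<in> carrier_mat n n" by auto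
  have "R\<^sup>T = R\<^sup>T * (Q * R)" using R by simp
  also have "\<dots> = (R\<^sup>T * Q) * R" using R Q by (intro assoc_mult_mat[symmetric, of _ n n _ n _ n]) auto
  also have "R\<^sup>T * Q = (Q * R)\<^sup>T" using transpose_mult[OF Q R(3)] Qp(1) by simp
  also have "\<dots> = 1\<^sub>m n" using R by simp
  finally have sym: "R\<^sup>T = R" using R by simp
  have "pos_def_mat R"
  proof (rule pos_def_matI[OF R(3) sym])
    fix v :: "real vec" assume v: "v \<in> carrier_vec n" "v \<noteq> 0\<^sub>v n"
    have Qv: "Q *\<^sub>v (R *\<^sub>v v) = v" using v R Q assoc_mult_mat_vec[OF Q R(3) v(1)] by simp
    hence "R *\<^sub>v v \<noteq> 0\<^sub>v n" using v mult_mat_vec_zero[OF Q] by auto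
    moreover have "R *\<^sub>v v \<in> carrier_vec n" using R v by auto
    ultimately have "(R *\<^sub>v v) \<bullet> (Q *\<^sub>v (R *\<^sub>v v)) > 0" using Qp(2) by blast
    thus "v \<bullet> (R *\<^sub>v v) > 0" unfolding Qv using v R by (simp add: comm_scalar_prod[of _ n])
  qed
  thus ?thesis using that inv R by blast
qed

lemma block_quadratic_form:
  fixes A B D :: "real mat"
  assumes A: "A \<in> carrier_mat k k" and B: "B \<in> carrier_mat n k" and D: "D \<in> carrier_mat n n"
    and x: "x \<in> carrier_vec k" and y: "y \<in> carrier_vec n"
  shows "(x @\<^sub>v y) \<bullet> (four_block_mat A B\<^sup>T B D *\<^sub>v (x @\<^sub>v y)) =
    x \<bullet> (A *\<^sub>v x) + 2 * (y \<bullet> (B *\<^sub>v x)) + y \<bullet> (D *\<^sub>v y)"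
proof -
  have "four_block_mat A B\<^sup>T B D *\<^sub>v (x @\<^sub>v y) = (A *\<^sub>v x + B\<^sup>T *\<^sub>v y) @\<^sub>v (B *\<^sub>v x + D *\<^sub>v y)"
    using assms by (intro four_block_mat_mult_vec) auto
  moreover have "x \<bullet> (B\<^sup>T *\<^sub>v y) = y \<bullet> (B *\<^sub>v x)"
    using transpose_vec_mult_scalar[OF B x y] assms by (subst comm_scalar_prod[of _ k]) auto
  ultimately show ?thesis
    using assms by (simp add: scalar_prod_append[of _ k _ n] scalar_prod_add_distrib[of _ k] scalar_prod_add_distrib[of _ n])
qed

text \<open>The identity behind the Schur complement: for positive definite \<open>D\<close> the
  expression is least at \<open>y = - Di *\<^sub>v b\<close>.\<close>

lemma complete_square:
  fixes D :: "real mat"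
  assumes D: "D \<in> carrier_mat n n" "D\<^sup>T = D" and Di: "Di \<in> carrier_mat n n" "D * Di = 1\<^sub>m n"
    and b: "b \<in> carrier_vec n" and y: "y \<in> carrier_vec n"
  shows "2 * (y \<bullet> b) + y \<bullet> (D *\<^sub>v y) =
    (y + Di *\<^sub>v b) \<bullet> (D *\<^sub>v (y + Di *\<^sub>v b)) - b \<bullet> (Di *\<^sub>v b)"
proof -
  define c where "c = Di *\<^sub>v b"
  have c: "c \<in> carrier_vec n" using Di b by (auto simp: c_def)
  have Dc: "D *\<^sub>v c = b" unfolding c_def using assoc_mult_mat_vec[OF D(1) Di(1) b] Di b by simp
  have "c \<bullet> (D *\<^sub>v y) = y \<bullet> b"
    using sym_mat_adjoint[OF D c y] Dc b y by (simp add: comm_scalar_prod[of b n])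
  moreover have "c \<bullet> b = b \<bullet> c" using b c by (rule comm_scalar_prod[rotated])
  moreover have "D *\<^sub>v (y + c) = D *\<^sub>v y + b" using mult_add_distrib_mat_vec[OF D(1) y c] Dc by simp
  moreover have "D *\<^sub>v y \<in> carrier_vec n" using D y by simp
  ultimately show ?thesis unfolding c_def[symmetric] using y c b
    by (simp add: scalar_prod_add_distrib[of _ n] add_scalar_prod_distrib[of _ n])
qed

lemma symmetric_four_block:
  assumes "A \<in> carrier_mat k k" "B \<in> carrier_mat n k" "D \<in> carrier_mat n n" "A\<^sup>T = A" "D\<^sup>T = D"
  shows "(four_block_mat A B\<^sup>T B D)\<^sup>T = four_block_mat A B\<^sup>T B D"
  using assms by (subst transpose_four_block_mat[of _ k k _ n _ n]) auto

text \<open>Restricts the form to vectors whose upper part vanishes; this later yields invertibility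
  of \<open>Xm * \<Theta>\<close>.\<close>

lemma pos_def_lower_block:
  assumes A: "A \<in> carrier_mat k k" and B: "B \<in> carrier_mat n k" and D: "D \<in> carrier_mat n n" "D\<^sup>T = D"
    and pd: "pos_def_mat (four_block_mat A B\<^sup>T B D)"
  shows "pos_def_mat D"
proof (rule pos_def_matI[OF D])
  fix y :: "real vec" assume y: "y \<in> carrier_vec n" "y \<noteq> 0\<^sub>v n"
  have "0\<^sub>v k @\<^sub>v y \<noteq> 0\<^sub>v (k + n)"
  proof
    assume "0\<^sub>v k @\<^sub>v y = 0\<^sub>v (k + n)"
    moreover have "0\<^sub>v (k + n) = 0\<^sub>v k @\<^sub>v (0\<^sub>v n :: real vec)" by (intro eq_vecI) auto
    ultimately have "0\<^sub>v k @\<^sub>v y = 0\<^sub>v k @\<^sub>v 0\<^sub>v n" by simp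
    thus False using y append_vec_eq[of "0\<^sub>v k" k "0\<^sub>v k" y "0\<^sub>v n"] by auto
  qed
  hence "(0\<^sub>v k @\<^sub>v y) \<bullet> (four_block_mat A B\<^sup>T B D *\<^sub>v (0\<^sub>v k @\<^sub>v y)) > 0"
    using y A D by (intro pos_def_matD(2)[OF pd, of "k + n"]) auto
  thus "y \<bullet> (D *\<^sub>v y) > 0"
    using A B D y mult_mat_vec_zero[OF A] mult_mat_vec_zero[OF B] by (subst (asm) block_quadratic_form[OF A B D(1)]) auto
qed

text \<open>Schur complement with respect to the lower block, phrased with quadratic forms:
  completing the square in the lower component separates a nonnegative term from the form of
  \<open>A - B\<^sup>T * Di * B\<close>.\<close>

lemma pos_def_block_iff:
  assumes A: "A \<in> carrier_mat k k" "A\<^sup>T = A" and B: "B \<in> carrier_mat n k"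
    and D: "D \<in> carrier_mat n n" "pos_def_mat D"
    and Di: "Di \<in> carrier_mat n n" "D * Di = 1\<^sub>m n"
  shows "pos_def_mat (four_block_mat A B\<^sup>T B D) \<longleftrightarrow>
    (\<forall>x\<in>carrier_vec k. x \<noteq> 0\<^sub>v k \<longrightarrow> (B *\<^sub>v x) \<bullet> (Di *\<^sub>v (B *\<^sub>v x)) < x \<bullet> (A *\<^sub>v x))"
    (is "pos_def_mat ?M \<longleftrightarrow> ?R")
proof -
  note Dp = pos_def_matD[OF D(2,1)]
  have quad: "(x @\<^sub>v y) \<bullet> (?M *\<^sub>v (x @\<^sub>v y)) = x \<bullet> (A *\<^sub>v x) - (B *\<^sub>v x) \<bullet> (Di *\<^sub>v (B *\<^sub>v x))
      + (y + Di *\<^sub>v (B *\<^sub>v x)) \<bullet> (D *\<^sub>v (y + Di *\<^sub>v (B *\<^sub>v x)))"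
    if "x \<in> carrier_vec k" "y \<in> carrier_vec n" for x y
    using block_quadratic_form[OF A(1) B D(1) that] complete_square[OF D(1) Dp(1) Di _ that(2), of "B *\<^sub>v x"] B that
    by simp
  have M: "?M \<in> carrier_mat (k + n) (k + n)" using A D by simp
  have zero: "x @\<^sub>v y = 0\<^sub>v (k + n) \<longleftrightarrow> x = 0\<^sub>v k \<and> y = 0\<^sub>v n"
    if "x \<in> carrier_vec k" "y \<in> carrier_vec n" for x y :: "real vec"
  proof -
    have "0\<^sub>v (k + n) = 0\<^sub>v k @\<^sub>v (0\<^sub>v n :: real vec)" by (intro eq_vecI) auto
    thus ?thesis using append_vec_eq[of x k "0\<^sub>v k" y "0\<^sub>v n"] that by simp
  qed
  show ?thesis
  proof
    assume pd: "pos_def_mat ?M"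
    show ?R
    proof (intro ballI impI)
      fix x :: "real vec" assume x: "x \<in> carrier_vec k" "x \<noteq> 0\<^sub>v k"
      let ?c = "Di *\<^sub>v (B *\<^sub>v x)"
      have c: "?c \<in> carrier_vec n" using Di B x by auto
      \<comment> \<open>The test vector has the minimiser \<open>- ?c\<close> as lower part, for
        which the completed square vanishes.\<close>
      have "(x @\<^sub>v - ?c) \<bullet> (?M *\<^sub>v (x @\<^sub>v - ?c)) > 0"
        using x c zero[OF x(1), of "- ?c"] by (intro pos_def_matD(2)[OF pd M]) auto
      moreover have "- ?c + ?c = 0\<^sub>v n" using c by simp
      ultimately show "(B *\<^sub>v x) \<bullet> (Di *\<^sub>v (B *\<^sub>v x)) < x \<bullet> (A *\<^sub>v x)"
        using quad[OF x(1), of "- ?c"] c D by simp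
    qed
  next
    assume r: ?R
    show "pos_def_mat ?M"
    proof (rule pos_def_matI[OF M symmetric_four_block[OF A(1) B D(1) A(2) Dp(1)]])
      fix v :: "real vec" assume v: "v \<in> carrier_vec (k + n)" "v \<noteq> 0\<^sub>v (k + n)"
      define x where "x = vec_first v k"
      define y where "y = vec_last v n"
      have xy: "v = x @\<^sub>v y" "x \<in> carrier_vec k" "y \<in> carrier_vec n" using v by (auto simp: x_def y_def)
      have c: "y + Di *\<^sub>v (B *\<^sub>v x) \<in> carrier_vec n" using xy Di B by auto
      show "v \<bullet> (?M *\<^sub>v v) > 0"
      proof (cases "x = 0\<^sub>v k")
        case True
        hence "y \<noteq> 0\<^sub>v n" using v xy zero by auto
        thus ?thesis unfolding xy(1) quad[OF xy(2,3)]
          using True Dp(2)[OF xy(3)] xy(3) mult_mat_vec_zero[OF A(1)] mult_mat_vec_zero[OF B] mult_mat_vec_zero[OF Di(1)] by simp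
      next
        case False
        thus ?thesis unfolding xy(1) quad[OF xy(2,3)] using r xy(2) Dp(3)[OF c] by auto
      qed
    qed
  qed
qed

text \<open>In \<open>three_block_mat\<close> the bottom block row is a transpose of stacked
  transposes, that is, two blocks side by side; it is read here as a four-block matrix whose lower
  blocks have no rows.\<close>

lemma three_block_append_mult:
  fixes G Z :: "real mat"
  assumes G: "G \<in> carrier_mat p k" and Z: "Z \<in> carrier_mat p n" and "x \<in> carrier_vec k" "y \<in> carrier_vec n"
  shows "(G\<^sup>T @\<^sub>r Z\<^sup>T)\<^sup>T *\<^sub>v (x @\<^sub>v y) = G *\<^sub>v x + Z *\<^sub>v y"
proof -
  have eq: "(G\<^sup>T @\<^sub>r Z\<^sup>T)\<^sup>T = four_block_mat G Z (0\<^sub>m 0 k) (0\<^sub>m 0 n)"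
    using assms by (intro eq_matI) (auto simp: append_rows_def)
  show ?thesis unfolding eq
    using assms by (subst four_block_mat_mult_vec[of _ p k _ n _ 0]) (auto intro!: eq_vecI)
qed

text \<open>An invertible matrix permutes the nonzero vectors, so \<open>x = R *\<^sub>v a\<close>
  is an admissible substitution; it exchanges inequalities for \<open>Q\<close> with inequalities
  for its inverse \<open>R\<close>.\<close>

lemma ball_nonzero_reparametrize:
  fixes Q R :: "real mat"
  assumes Q: "Q \<in> carrier_mat n n" and R: "R \<in> carrier_mat n n" "Q * R = 1\<^sub>m n" "R * Q = 1\<^sub>m n"
  shows "(\<forall>x\<in>carrier_vec n. x \<noteq> 0\<^sub>v n \<longrightarrow> P x) \<longleftrightarrow> (\<forall>a\<in>carrier_vec n. a \<noteq> 0\<^sub>v n \<longrightarrow> P (R *\<^sub>v a))"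
proof -
  have QR: "Q *\<^sub>v (R *\<^sub>v a) = a" and RQ: "R *\<^sub>v (Q *\<^sub>v a) = a" if "a \<in> carrier_vec n" for a
    using assoc_mult_mat_vec[OF Q R(1) that] assoc_mult_mat_vec[OF R(1) Q that] R that by auto
  note zero = mult_mat_vec_zero[OF Q] mult_mat_vec_zero[OF R(1)]
  show ?thesis
  proof (intro iffI ballI impI)
    fix a :: "real vec" assume *: "\<forall>x\<in>carrier_vec n. x \<noteq> 0\<^sub>v n \<longrightarrow> P x" and a: "a \<in> carrier_vec n" "a \<noteq> 0\<^sub>v n"
    have "R *\<^sub>v a \<noteq> 0\<^sub>v n" using QR[OF a(1)] a(2) zero by auto
    thus "P (R *\<^sub>v a)" using * R(1) a by auto
  next
    fix x :: "real vec" assume *: "\<forall>a\<in>carrier_vec n. a \<noteq> 0\<^sub>v n \<longrightarrow> P (R *\<^sub>v a)" and x: "x \<in> carrier_vec n" "x \<noteq> 0\<^sub>v n"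
    have "Q *\<^sub>v x \<noteq> 0\<^sub>v n" using RQ[OF x(1)] x(2) zero by auto
    hence "P (R *\<^sub>v (Q *\<^sub>v x))" using * Q x by auto
    thus "P x" using RQ[OF x(1)] by simp
  qed
qed

section \<open>Block matrix conditions as Lyapunov inequalities\<close>

context
  fixes Q R F :: "real mat" and n :: nat
  assumes Q: "Q \<in> carrier_mat n n" "pos_def_mat Q"
    and R: "R \<in> carrier_mat n n" "Q * R = 1\<^sub>m n" "R * Q = 1\<^sub>m n"
    and F: "F \<in> carrier_mat n n"
begin

private lemma mult_inverse_vec:
  assumes "G \<in> carrier_mat p n" "a \<in> carrier_vec n"
  shows "(G * Q) *\<^sub>v (R *\<^sub>v a) = G *\<^sub>v a"
proof -
  have Ra: "R *\<^sub>v a \<in> carrier_vec n" using R assms by auto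
  have "(G * Q) *\<^sub>v (R *\<^sub>v a) = G *\<^sub>v (Q *\<^sub>v (R *\<^sub>v a))" by (rule assoc_mult_mat_vec[OF assms(1) Q(1) Ra])
  also have "Q *\<^sub>v (R *\<^sub>v a) = a" using assoc_mult_mat_vec[OF Q(1) R(1) assms(2)] R assms by simp
  finally show ?thesis .
qed

private lemma quad_inverse_vec:
  assumes "a \<in> carrier_vec n"
  shows "(R *\<^sub>v a) \<bullet> (Q *\<^sub>v (R *\<^sub>v a)) = a \<bullet> (R *\<^sub>v a)"
proof -
  have "Q *\<^sub>v (R *\<^sub>v a) = a" using assoc_mult_mat_vec[OF Q(1) R(1) assms(1)] R assms by simp
  thus ?thesis using R assms by (simp add: comm_scalar_prod[of _ n])
qed

text \<open>Schur complement by the lower \<open>Q\<close>, followed by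
  \<open>x = R *\<^sub>v a\<close>: \<open>F * Q\<close> becomes \<open>F\<close> and the form of
  \<open>Q\<close> becomes that of \<open>R\<close>.\<close>

lemma pos_def_lyapunov_block_iff:
  "pos_def_mat (four_block_mat Q (F * Q)\<^sup>T (F * Q) Q) \<longleftrightarrow>
    (\<forall>a\<in>carrier_vec n. a \<noteq> 0\<^sub>v n \<longrightarrow> (F *\<^sub>v a) \<bullet> (R *\<^sub>v (F *\<^sub>v a)) < a \<bullet> (R *\<^sub>v a))"
proof -
  have "F * Q \<in> carrier_mat n n" using F Q by auto
  from pos_def_block_iff[OF Q(1) pos_def_matD(1)[OF Q(2,1)] this Q R(1,2)] show ?thesis
    by (subst (asm) ball_nonzero_reparametrize[OF Q(1) R]) (simp add: mult_inverse_vec[OF F] quad_inverse_vec)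
qed

text \<open>Two Schur complements in succession: the identity block is eliminated first, which
  subtracts the output term in the upper left corner, then the lower \<open>Q\<close>.\<close>

lemma pos_def_three_block_iff:
  assumes G: "G \<in> carrier_mat p n"
  shows "pos_def_mat (three_block_mat Q (F * Q)\<^sup>T (G * Q)\<^sup>T (F * Q) Q (0\<^sub>m n p) (G * Q) (0\<^sub>m p n) (1\<^sub>m p)) \<longleftrightarrow>
    (\<forall>a\<in>carrier_vec n. a \<noteq> 0\<^sub>v n \<longrightarrow> (F *\<^sub>v a) \<bullet> (R *\<^sub>v (F *\<^sub>v a)) + (G *\<^sub>v a) \<bullet> (G *\<^sub>v a) < a \<bullet> (R *\<^sub>v a))"
    (is "pos_def_mat ?M \<longleftrightarrow> ?S")
proof -
  note sym = pos_def_matD(1)[OF Q(2,1)]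
  have FQ: "F * Q \<in> carrier_mat n n" and GQ: "G * Q \<in> carrier_mat p n" using F G Q by auto
  define N where "N = four_block_mat Q (F * Q)\<^sup>T (F * Q) Q"
  \<comment> \<open>The upper left corner after elimination of the identity block; \<open>V\<close>
    below is the last block row, \<open>G * Q\<close> next to zero.\<close>
  define A where "A = Q - (G * Q)\<^sup>T * (G * Q)"
  define N' where "N' = four_block_mat A (F * Q)\<^sup>T (F * Q) Q"
  define V where "V = ((G * Q)\<^sup>T @\<^sub>r (0\<^sub>m p n)\<^sup>T)\<^sup>T"
  have N: "N \<in> carrier_mat (n + n) (n + n)" "N\<^sup>T = N"
    using Q symmetric_four_block[OF Q(1) FQ Q(1) sym sym] by (auto simp: N_def)
  have H: "(G * Q)\<^sup>T * (G * Q) \<in> carrier_mat n n" "((G * Q)\<^sup>T * (G * Q))\<^sup>T = (G * Q)\<^sup>T * (G * Q)"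
    using GQ transpose_mult[of "(G * Q)\<^sup>T" n p "G * Q" n] by (auto simp del: transpose_mat_eq)
  have A: "A \<in> carrier_mat n n" unfolding A_def by (rule minus_carrier_mat[OF H(1)])
  have At: "A\<^sup>T = A" unfolding A_def transpose_minus[OF Q(1) H(1)] H(2) sym ..
  have N': "N' \<in> carrier_mat (n + n) (n + n)" "N'\<^sup>T = N'"
    using Q A symmetric_four_block[OF A FQ Q(1) At sym] by (auto simp: N'_def)
  have V: "V \<in> carrier_mat p (n + n)" using GQ by (auto simp: V_def)
  have quadA: "x \<bullet> (A *\<^sub>v x) = x \<bullet> (Q *\<^sub>v x) - ((G * Q) *\<^sub>v x) \<bullet> ((G * Q) *\<^sub>v x)" if x: "x \<in> carrier_vec n" for x
  proof -
    have gx: "(G * Q) *\<^sub>v x \<in> carrier_vec p" using GQ x by auto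
    have "A *\<^sub>v x = Q *\<^sub>v x - (G * Q)\<^sup>T *\<^sub>v ((G * Q) *\<^sub>v x)"
      unfolding A_def using GQ Q x by (subst minus_mult_distrib_mat_vec[of _ n n]) (auto simp: assoc_mult_mat_vec[of _ n p _ n])
    moreover have "x \<bullet> ((G * Q)\<^sup>T *\<^sub>v ((G * Q) *\<^sub>v x)) = ((G * Q) *\<^sub>v x) \<bullet> ((G * Q) *\<^sub>v x)"
      using transpose_vec_mult_scalar[OF GQ x gx] x GQ gx by (subst comm_scalar_prod[of _ n]) auto
    ultimately show ?thesis using Q GQ x gx by (simp add: scalar_prod_minus_distrib[of _ n])
  qed
  have quad: "z \<bullet> (N' *\<^sub>v z) = z \<bullet> (N *\<^sub>v z) - (V *\<^sub>v z) \<bullet> (V *\<^sub>v z)" if z: "z \<in> carrier_vec (n + n)" for z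
  proof -
    obtain x y where xy: "z = x @\<^sub>v y" "x \<in> carrier_vec n" "y \<in> carrier_vec n"
      using vec_first_last_append[OF z] vec_first_carrier vec_last_carrier by metis
    have zero_mult: "0\<^sub>m p n *\<^sub>v y = 0\<^sub>v p" using xy by (intro eq_vecI) auto
    have "V *\<^sub>v z = (G * Q) *\<^sub>v x" unfolding V_def xy(1)
      using xy GQ zero_mult by (subst three_block_append_mult[of _ p n _ n]) auto
    thus ?thesis unfolding xy(1) N_def N'_def
      by (simp add: block_quadratic_form[OF A FQ Q(1) xy(2,3)] block_quadratic_form[OF Q(1) FQ Q(1) xy(2,3)] quadA[OF xy(2)])
  qed
  have "?M = four_block_mat N V\<^sup>T V (1\<^sub>m p)"
    by (simp add: three_block_mat_def N_def V_def)
  also have "pos_def_mat \<dots> \<longleftrightarrow>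
      (\<forall>z\<in>carrier_vec (n + n). z \<noteq> 0\<^sub>v (n + n) \<longrightarrow> (V *\<^sub>v z) \<bullet> (1\<^sub>m p *\<^sub>v (V *\<^sub>v z)) < z \<bullet> (N *\<^sub>v z))"
    by (rule pos_def_block_iff[OF N V _ pos_def_one]) auto
  also have "\<dots> \<longleftrightarrow> (\<forall>z\<in>carrier_vec (n + n). z \<noteq> 0\<^sub>v (n + n) \<longrightarrow> 0 < z \<bullet> (N' *\<^sub>v z))"
    using V by (intro ball_cong imp_cong refl) (simp add: quad)
  also have "\<dots> \<longleftrightarrow> pos_def_mat N'"
    using pos_def_matI[OF N'] pos_def_matD(2)[OF _ N'(1)] by blast
  also have "\<dots> \<longleftrightarrow> (\<forall>x\<in>carrier_vec n. x \<noteq> 0\<^sub>v n \<longrightarrow> ((F * Q) *\<^sub>v x) \<bullet> (R *\<^sub>v ((F * Q) *\<^sub>v x)) < x \<bullet> (A *\<^sub>v x))"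
    unfolding N'_def by (rule pos_def_block_iff[OF A At FQ Q R(1,2)])
  also have "\<dots> \<longleftrightarrow> ?S"
    using R by (subst ball_nonzero_reparametrize[OF Q(1) R], intro ball_cong imp_cong refl)
      (simp add: quadA mult_inverse_vec[OF F] mult_inverse_vec[OF G] quad_inverse_vec less_diff_eq)
  finally show ?thesis .
qed

end

subsection \<open>Discrete Lyapunov equations and output energy\<close>

lemma bilinear_form_eq_sum:
  fixes M :: "real mat"
  assumes "M \<in> carrier_mat n k" "u \<in> carrier_vec n" "v \<in> carrier_vec k"
  shows "u \<bullet> (M *\<^sub>v v) = (\<Sum>i<n. \<Sum>j<k. u $ i * M $$ (i,j) * v $ j)"
  using assms by (auto simp: scalar_prod_def lessThan_atLeast0 sum_distrib_left mult.assoc intro!: sum.cong)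

text \<open>The entries of the summands are dominated by a geometric series with ratio
  \<open>r * r\<close>, so their sum \<open>R\<close> is formed entrywise. Two independent vectors
  \<open>u\<close> and \<open>v\<close> are kept so that symmetry of \<open>R\<close> can later be
  deduced from that of \<open>S\<close>.\<close>

lemma gramian_exists:
  fixes F S :: "real mat"
  assumes F: "F \<in> carrier_mat n n" and st: "stable_mat F" and S: "S \<in> carrier_mat n n"
  obtains R where "R \<in> carrier_mat n n"
    "\<And>u v. u \<in> carrier_vec n \<Longrightarrow> v \<in> carrier_vec n \<Longrightarrow>
      (\<lambda>t. (F ^\<^sub>m t *\<^sub>v u) \<bullet> (S *\<^sub>v (F ^\<^sub>m t *\<^sub>v v))) sums (u \<bullet> (R *\<^sub>v v))"
proof -
  obtain c r where r: "0 < r" "r < 1" and c: "\<And>t i j. i < n \<Longrightarrow> j < n \<Longrightarrow> \<bar>(F ^\<^sub>m t) $$ (i,j)\<bar> \<le> c * r ^ t"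
    by (rule stable_mat_pow_geometric[OF F st]) (rule that)
  define P where "P t = F ^\<^sub>m t" for t
  have Ft: "P t \<in> carrier_mat n n" for t unfolding P_def by (rule pow_carrier_mat[OF F])
  define N where "N t = (P t)\<^sup>T * (S * P t)" for t
  have N: "N t \<in> carrier_mat n n" for t using Ft[of t] S by (auto simp: N_def)
  have N_form: "u \<bullet> (N t *\<^sub>v v) = (P t *\<^sub>v u) \<bullet> (S *\<^sub>v (P t *\<^sub>v v))"
    if u: "u \<in> carrier_vec n" and v: "v \<in> carrier_vec n" for t u v
  proof -
    let ?w = "S *\<^sub>v (P t *\<^sub>v v)"
    have w: "?w \<in> carrier_vec n" using S Ft[of t] v by auto
    have "N t *\<^sub>v v = (P t)\<^sup>T *\<^sub>v ?w"
      unfolding N_def using S Ft[of t] v by (subst assoc_mult_mat_vec[of _ n n _ n]) (auto simp: assoc_mult_mat_vec[of _ n n _ n])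
    hence "u \<bullet> (N t *\<^sub>v v) = ((P t)\<^sup>T *\<^sub>v ?w) \<bullet> u"
      using u w Ft[of t] by (simp add: comm_scalar_prod[of u n])
    also have "\<dots> = ?w \<bullet> (P t *\<^sub>v u)" by (rule transpose_vec_mult_scalar[OF Ft u w])
    also have "\<dots> = (P t *\<^sub>v u) \<bullet> ?w" using w Ft[of t] u by (intro comm_scalar_prod[of _ n]) auto
    finally show ?thesis .
  qed
  have entry: "N t $$ (i,j) = (\<Sum>k<n. \<Sum>l<n. P t $$ (k,i) * S $$ (k,l) * P t $$ (l,j))"
    if ij: "i < n" "j < n" for t i j
  proof -
    have SP: "S * P t \<in> carrier_mat n n" using S Ft[of t] by auto
    have "N t $$ (i,j) = row (P t)\<^sup>T i \<bullet> col (S * P t) j"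
      unfolding N_def using Ft[of t] SP ij by (intro index_mult_mat(1)) auto
    also have "row (P t)\<^sup>T i = col (P t) i" using Ft[of t] ij by (intro row_transpose) auto
    also have "col (S * P t) j = S *\<^sub>v col (P t) j" by (rule col_mult2[OF S Ft ij(2)])
    finally have "N t $$ (i,j) = col (P t) i \<bullet> (S *\<^sub>v col (P t) j)" .
    also have "\<dots> = (\<Sum>k<n. \<Sum>l<n. P t $$ (k,i) * S $$ (k,l) * P t $$ (l,j))"
      using S carrier_matD[OF Ft[of t]] ij col_carrier_vec[OF _ Ft[of t]]
      by (subst bilinear_form_eq_sum[OF S]) auto
    finally show ?thesis .
  qed
  have summable: "summable (\<lambda>t. N t $$ (i,j))" if ij: "i < n" "j < n" for i j
    unfolding entry[OF ij]
  proof (intro summable_sum)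
    fix k l assume kl: "k \<in> {..<n}" "l \<in> {..<n}"
    show "summable (\<lambda>t. P t $$ (k,i) * S $$ (k,l) * P t $$ (l,j))"
    proof (rule summable_comparison_test')
      have "r * r < 1" using r mult_strict_mono[of r 1 r 1] by simp
      thus "summable (\<lambda>t. c * c * \<bar>S $$ (k,l)\<bar> * (r * r) ^ t)"
        using r by (intro summable_mult summable_geometric) auto
      fix t :: nat
      have "\<bar>P t $$ (k,i)\<bar> * \<bar>P t $$ (l,j)\<bar> \<le> (c * r ^ t) * (c * r ^ t)"
        using c[of k i t, folded P_def] c[of l j t, folded P_def] kl ij by (intro mult_mono) (auto intro: order_trans[OF abs_ge_zero])
      hence "\<bar>S $$ (k,l)\<bar> * (\<bar>P t $$ (k,i)\<bar> * \<bar>P t $$ (l,j)\<bar>) \<le> \<bar>S $$ (k,l)\<bar> * ((c * r ^ t) * (c * r ^ t))"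
        by (rule mult_left_mono) simp
      thus "norm (P t $$ (k,i) * S $$ (k,l) * P t $$ (l,j)) \<le> c * c * \<bar>S $$ (k,l)\<bar> * (r * r) ^ t"
        by (simp add: abs_mult power_mult_distrib ac_simps)
    qed
  qed
  define R where "R = mat n n (\<lambda>(i,j). \<Sum>t. N t $$ (i,j))"
  have R: "R \<in> carrier_mat n n" by (simp add: R_def)
  show ?thesis
  proof (rule that[OF R])
    fix u v :: "real vec" assume uv: "u \<in> carrier_vec n" "v \<in> carrier_vec n"
    have "(\<lambda>t. \<Sum>i<n. \<Sum>j<n. u $ i * N t $$ (i,j) * v $ j) sums (\<Sum>i<n. \<Sum>j<n. u $ i * R $$ (i,j) * v $ j)"
    proof (intro sums_sum sums_mult sums_mult2)
      fix i j assume "i \<in> {..<n}" "j \<in> {..<n}"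
      thus "(\<lambda>t. N t $$ (i,j)) sums R $$ (i,j)" using summable_sums[OF summable, of i j] by (simp add: R_def)
    qed
    thus "(\<lambda>t. (F ^\<^sub>m t *\<^sub>v u) \<bullet> (S *\<^sub>v (F ^\<^sub>m t *\<^sub>v v))) sums (u \<bullet> (R *\<^sub>v v))"
      unfolding P_def[symmetric] by (simp add: N_form[OF uv, symmetric] bilinear_form_eq_sum[OF N uv] bilinear_form_eq_sum[OF R uv])
  qed
qed

lemma eq_transpose_if_form_symmetric:
  fixes R :: "real mat"
  assumes R: "R \<in> carrier_mat n n"
    and sym: "\<And>u v. u \<in> carrier_vec n \<Longrightarrow> v \<in> carrier_vec n \<Longrightarrow> u \<bullet> (R *\<^sub>v v) = v \<bullet> (R *\<^sub>v u)"
  shows "R\<^sup>T = R"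
proof (rule eq_matI)
  fix i j assume ij: "i < dim_row R" "j < dim_col R"
  hence "R $$ (j,i) = R $$ (i,j)"
    using sym[of "unit_vec n j" "unit_vec n i"] R by simp
  thus "R\<^sup>T $$ (i,j) = R $$ (i,j)" using R ij by simp
qed (use R in auto)

lemma pow_mat_Suc_vec:
  assumes F: "(F :: 'a :: comm_semiring_1 mat) \<in> carrier_mat n n" and v: "v \<in> carrier_vec n"
  shows "F ^\<^sub>m Suc t *\<^sub>v v = F ^\<^sub>m t *\<^sub>v (F *\<^sub>v v)"
  using assoc_mult_mat_vec[OF pow_carrier_mat[OF F] F v] by simp

text \<open>The series for \<open>F *\<^sub>v v\<close> is the series for \<open>v\<close> without
  its first term; this shift is the Lyapunov equation.\<close>

lemma discrete_lyapunov_solution: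
  fixes F S :: "real mat"
  assumes F: "F \<in> carrier_mat n n" and st: "stable_mat F" and S: "S \<in> carrier_mat n n" "S\<^sup>T = S"
  obtains R where "R \<in> carrier_mat n n" "R\<^sup>T = R"
    "\<And>v. v \<in> carrier_vec n \<Longrightarrow> (\<lambda>t. (F ^\<^sub>m t *\<^sub>v v) \<bullet> (S *\<^sub>v (F ^\<^sub>m t *\<^sub>v v))) sums (v \<bullet> (R *\<^sub>v v))"
    "\<And>v. v \<in> carrier_vec n \<Longrightarrow> v \<bullet> (R *\<^sub>v v) = v \<bullet> (S *\<^sub>v v) + (F *\<^sub>v v) \<bullet> (R *\<^sub>v (F *\<^sub>v v))"
proof -
  obtain R where R: "R \<in> carrier_mat n n" and sums: "\<And>u v. u \<in> carrier_vec n \<Longrightarrow> v \<in> carrier_vec n \<Longrightarrow>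
      (\<lambda>t. (F ^\<^sub>m t *\<^sub>v u) \<bullet> (S *\<^sub>v (F ^\<^sub>m t *\<^sub>v v))) sums (u \<bullet> (R *\<^sub>v v))"
    using gramian_exists[OF F st S(1)] by blast
  have Ftv: "F ^\<^sub>m t *\<^sub>v v \<in> carrier_vec n" if "v \<in> carrier_vec n" for t v
    using pow_carrier_mat[OF F] that by (rule mult_mat_vec_carrier)
  show ?thesis
  proof (rule that[OF R])
    show "R\<^sup>T = R"
    proof (rule eq_transpose_if_form_symmetric[OF R])
      fix u v :: "real vec" assume uv: "u \<in> carrier_vec n" "v \<in> carrier_vec n"
      have "(F ^\<^sub>m t *\<^sub>v u) \<bullet> (S *\<^sub>v (F ^\<^sub>m t *\<^sub>v v)) = (F ^\<^sub>m t *\<^sub>v v) \<bullet> (S *\<^sub>v (F ^\<^sub>m t *\<^sub>v u))" for t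
        using sym_mat_adjoint[OF S Ftv[OF uv(1)] Ftv[OF uv(2)], symmetric] Ftv[OF uv(1), of t] Ftv[OF uv(2), of t] S
        by (simp add: comm_scalar_prod[of _ n])
      thus "u \<bullet> (R *\<^sub>v v) = v \<bullet> (R *\<^sub>v u)" using sums[OF uv] sums[OF uv(2,1)] by (simp add: sums_unique2)
    qed
    fix v :: "real vec" assume v: "v \<in> carrier_vec n"
    show s: "(\<lambda>t. (F ^\<^sub>m t *\<^sub>v v) \<bullet> (S *\<^sub>v (F ^\<^sub>m t *\<^sub>v v))) sums (v \<bullet> (R *\<^sub>v v))" by (rule sums[OF v v])
    have Fv: "F *\<^sub>v v \<in> carrier_vec n" using F v by auto
    have "(\<lambda>t. (F ^\<^sub>m Suc t *\<^sub>v v) \<bullet> (S *\<^sub>v (F ^\<^sub>m Suc t *\<^sub>v v))) sums ((F *\<^sub>v v) \<bullet> (R *\<^sub>v (F *\<^sub>v v)))"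
      unfolding pow_mat_Suc_vec[OF F v] by (rule sums[OF Fv Fv])
    hence "(\<lambda>t. (F ^\<^sub>m t *\<^sub>v v) \<bullet> (S *\<^sub>v (F ^\<^sub>m t *\<^sub>v v))) sums
        ((F *\<^sub>v v) \<bullet> (R *\<^sub>v (F *\<^sub>v v)) + (F ^\<^sub>m 0 *\<^sub>v v) \<bullet> (S *\<^sub>v (F ^\<^sub>m 0 *\<^sub>v v)))"
      by (rule sums_Suc)
    thus "v \<bullet> (R *\<^sub>v v) = v \<bullet> (S *\<^sub>v v) + (F *\<^sub>v v) \<bullet> (R *\<^sub>v (F *\<^sub>v v))"
      using sums_unique2[OF s] F v by simp
  qed
qed

text \<open>For a complex eigenvector \<open>a + i b\<close> with eigenvalue \<open>k\<close>, the
  Hermitian form of \<open>R\<close> is \<open>q a + q b\<close>. Applying \<open>F\<close>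
  multiplies it by the square of \<open>cmod k\<close> and strictly decreases it.\<close>

lemma stable_mat_if_lyapunov:
  fixes F R :: "real mat"
  assumes F: "F \<in> carrier_mat n n" and R: "R \<in> carrier_mat n n" "pos_def_mat R"
    and dec: "\<And>a. a \<in> carrier_vec n \<Longrightarrow> a \<noteq> 0\<^sub>v n \<Longrightarrow> (F *\<^sub>v a) \<bullet> (R *\<^sub>v (F *\<^sub>v a)) < a \<bullet> (R *\<^sub>v a)"
  shows "stable_mat F"
  unfolding stable_mat_def
proof (intro conjI allI impI)
  show "square_mat F" using F by (simp add: square_mat.simps)
  fix k assume "eigenvalue (map_mat complex_of_real F) k"
  then obtain v where v: "v \<in> carrier_vec n" "v \<noteq> 0\<^sub>v n" "map_mat complex_of_real F *\<^sub>v v = k \<cdot>\<^sub>v v"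
    using F by (auto simp: eigenvalue_def eigenvector_def)
  define a where "a = map_vec Re v"
  define b where "b = map_vec Im v"
  have ab: "a \<in> carrier_vec n" "b \<in> carrier_vec n" using v by (auto simp: a_def b_def)
  have entry: "(\<Sum>j<n. complex_of_real (F $$ (i,j)) * v $ j) = k * v $ i" if "i < n" for i
    using arg_cong[OF v(3), of "\<lambda>w. w $ i"] that v(1) F by (simp add: scalar_prod_def lessThan_atLeast0)
  have Fa: "F *\<^sub>v a = Re k \<cdot>\<^sub>v a - Im k \<cdot>\<^sub>v b" and Fb: "F *\<^sub>v b = Re k \<cdot>\<^sub>v b + Im k \<cdot>\<^sub>v a"
    using arg_cong[OF entry, of _ Re] arg_cong[OF entry, of _ Im] F v(1)
    by (auto intro!: eq_vecI simp: a_def b_def scalar_prod_def lessThan_atLeast0)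
  note Rp = pos_def_matD[OF R(2,1)]
  define q where "q x = x \<bullet> (R *\<^sub>v x)" for x
  have Rab: "R *\<^sub>v a \<in> carrier_vec n" "R *\<^sub>v b \<in> carrier_vec n" using R ab by auto
  have cross: "b \<bullet> (R *\<^sub>v a) = a \<bullet> (R *\<^sub>v b)"
    using sym_mat_adjoint[OF R(1) Rp(1) ab] Rab ab by (simp add: comm_scalar_prod[of _ n])
  have q_comb: "q (s \<cdot>\<^sub>v a + t \<cdot>\<^sub>v b) = s^2 * q a + 2 * s * t * (a \<bullet> (R *\<^sub>v b)) + t^2 * q b" for s t
  proof -
    have "R *\<^sub>v (s \<cdot>\<^sub>v a + t \<cdot>\<^sub>v b) = s \<cdot>\<^sub>v (R *\<^sub>v a) + t \<cdot>\<^sub>v (R *\<^sub>v b)"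
      using R ab by (simp add: mult_add_distrib_mat_vec[of _ n n] mult_mat_vec[of _ n n])
    thus ?thesis using ab Rab cross
      by (simp add: q_def scalar_prod_add_distrib[of _ n] add_scalar_prod_distrib[of _ n] algebra_simps power2_eq_square)
  qed
  have "F *\<^sub>v a = Re k \<cdot>\<^sub>v a + (- Im k) \<cdot>\<^sub>v b" unfolding Fa using ab by (intro eq_vecI) auto
  moreover have "F *\<^sub>v b = Im k \<cdot>\<^sub>v a + Re k \<cdot>\<^sub>v b" unfolding Fb using ab by (intro eq_vecI) auto
  \<comment> \<open>The mixed terms of \<open>q (F a)\<close> and \<open>q (F b)\<close> are
    opposite and cancel.\<close>
  ultimately have "q (F *\<^sub>v a) + q (F *\<^sub>v b) = (cmod k)^2 * (q a + q b)"
    unfolding cmod_power2 by (simp only: q_comb) (simp add: algebra_simps)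
  moreover have "q (F *\<^sub>v a) + q (F *\<^sub>v b) < q a + q b" and "q a + q b > 0"
  proof -
    have F0: "F *\<^sub>v 0\<^sub>v n = 0\<^sub>v n" using mult_mat_vec_zero[OF F] .
    have le: "q (F *\<^sub>v x) \<le> q x" "q x \<ge> 0" if "x \<in> carrier_vec n" for x
      using dec[OF that] Rp(3)[OF that] F0 by (cases "x = 0\<^sub>v n"; force simp: q_def)+
    have lt: "q (F *\<^sub>v x) < q x" "q x > 0" if "x \<in> carrier_vec n" "x \<noteq> 0\<^sub>v n" for x
      using dec[OF that] Rp(2)[OF that] by (auto simp: q_def)
    have "a \<noteq> 0\<^sub>v n \<or> b \<noteq> 0\<^sub>v n"
    proof (rule ccontr)
      assume "\<not> ?thesis"
      hence z: "a = 0\<^sub>v n" "b = 0\<^sub>v n" by auto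
      have "v = 0\<^sub>v n"
      proof (rule eq_vecI)
        fix i assume "i < dim_vec (0\<^sub>v n :: complex vec)"
        thus "v $ i = 0\<^sub>v n $ i"
          using arg_cong[OF z(1), of "\<lambda>w. w $ i"] arg_cong[OF z(2), of "\<lambda>w. w $ i"] v(1)
          by (simp add: a_def b_def complex_eq_iff)
      qed (use v in auto)
      thus False using v by simp
    qed
    thus "q (F *\<^sub>v a) + q (F *\<^sub>v b) < q a + q b" "q a + q b > 0"
      using le[OF ab(1)] le[OF ab(2)] lt[OF ab(1)] lt[OF ab(2)] by force+
  qed
  ultimately have "(cmod k)^2 < 1" by (metis mult.left_neutral mult_less_cancel_right_pos)
  thus "cmod k < 1" by (simp add: power_less_one_iff abs_square_less_1)
qed

text \<open>Telescopes the dissipation inequality along the trajectory from \<open>v\<close>. The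
  induction peels off the first step, with \<open>F *\<^sub>v v\<close> as the new start, and
  \<open>nonneg\<close> disposes of the form left at the end.\<close>

lemma sum_output_energy_le:
  fixes F R G :: "real mat"
  assumes F: "F \<in> carrier_mat n n"
    and nonneg: "\<And>a. a \<in> carrier_vec n \<Longrightarrow> 0 \<le> a \<bullet> (R *\<^sub>v a)"
    and dec: "\<And>a. a \<in> carrier_vec n \<Longrightarrow>
      (F *\<^sub>v a) \<bullet> (R *\<^sub>v (F *\<^sub>v a)) + (G *\<^sub>v a) \<bullet> (G *\<^sub>v a) \<le> a \<bullet> (R *\<^sub>v a)"
    and v: "v \<in> carrier_vec n"
  shows "(\<Sum>t<N. (G *\<^sub>v (F ^\<^sub>m t *\<^sub>v v)) \<bullet> (G *\<^sub>v (F ^\<^sub>m t *\<^sub>v v))) \<le> v \<bullet> (R *\<^sub>v v)"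
  using v
proof (induction N arbitrary: v)
  case 0
  thus ?case using nonneg by simp
next
  case (Suc N)
  have Fv: "F *\<^sub>v v \<in> carrier_vec n" using F Suc.prems by auto
  have "F ^\<^sub>m 0 *\<^sub>v v = v" using F Suc.prems by simp
  thus ?case
    unfolding sum.lessThan_Suc_shift pow_mat_Suc_vec[OF F Suc.prems]
    using Suc.IH[OF Fv] dec[OF Suc.prems] by simp
qed

section \<open>The cost as output energy\<close>

lemma mat_trace_gram:
  fixes M :: "real mat"
  assumes "M \<in> carrier_mat p d"
  shows "mat_trace (M\<^sup>T * M) = (\<Sum>j<d. col M j \<bullet> col M j)"
  using assms by (auto simp: mat_trace_def)

text \<open>Each term of the cost is the output energy at time \<open>t\<close> of the
  \<open>d\<close> free trajectories started at the columns of \<open>E\<close>, so Gramians apply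
  column by column.\<close>

lemma trace_closed_loop_response:
  assumes "C \<in> carrier_mat p n" "D \<in> carrier_mat p m" "K \<in> carrier_mat m n"
    and "A \<in> carrier_mat n n" "B \<in> carrier_mat n m" and E: "E \<in> carrier_mat n d"
  shows "mat_trace ((closed_loop_response C D A B E K t)\<^sup>T * closed_loop_response C D A B E K t) =
    (\<Sum>j<d. ((C + D * K) *\<^sub>v ((A + B * K) ^\<^sub>m t *\<^sub>v col E j)) \<bullet> ((C + D * K) *\<^sub>v ((A + B * K) ^\<^sub>m t *\<^sub>v col E j)))"
proof -
  define F where "F = A + B * K"
  define G where "G = C + D * K"
  have F: "F ^\<^sub>m t \<in> carrier_mat n n" unfolding F_def using assms by (intro pow_carrier_mat) auto
  have G: "G \<in> carrier_mat p n" using assms by (auto simp: G_def)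
  have T: "closed_loop_response C D A B E K t = G * (F ^\<^sub>m t * E)"
    unfolding closed_loop_response_def F_def[symmetric] G_def[symmetric] by (rule assoc_mult_mat[OF G F E])
  have FE: "F ^\<^sub>m t * E \<in> carrier_mat n d" using F E by auto
  have col: "col (G * (F ^\<^sub>m t * E)) j = G *\<^sub>v (F ^\<^sub>m t *\<^sub>v col E j)" if "j < d" for j
    using col_mult2[OF G FE that] col_mult2[OF F E that] by simp
  have "G * (F ^\<^sub>m t * E) \<in> carrier_mat p d" using G FE by auto
  from mat_trace_gram[OF this] show ?thesis
    unfolding T F_def[symmetric] G_def[symmetric] by (simp add: col)
qed

lemma transpose_smult_mat: "(c \<cdot>\<^sub>m M)\<^sup>T = c \<cdot>\<^sub>m M\<^sup>T"
  by (intro eq_matI) auto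

lemma sq_entry_le_scalar_prod_self:
  fixes x :: "real vec"
  assumes "i < dim_vec x"
  shows "(x $ i)\<^sup>2 \<le> x \<bullet> x"
  unfolding scalar_prod_def using assms
  by (subst power2_eq_square, intro member_le_sum) auto

lemma gram_form:
  assumes G: "G \<in> carrier_mat p n" and v: "v \<in> carrier_vec n"
  shows "v \<bullet> ((G\<^sup>T * G) *\<^sub>v v) = (G *\<^sub>v v) \<bullet> (G *\<^sub>v (v :: real vec))"
proof -
  have Gv: "G *\<^sub>v v \<in> carrier_vec p" using G v by auto
  have "(G\<^sup>T * G) *\<^sub>v v = G\<^sup>T *\<^sub>v (G *\<^sub>v v)" using G v by (intro assoc_mult_mat_vec[of _ n p _ n]) auto
  thus ?thesis using transpose_vec_mult_scalar[OF G v Gv] G v Gv by (simp add: comm_scalar_prod[of v n])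
qed

text \<open>The observability Gramian: the weight is \<open>G\<^sup>T * G\<close>, whose form is the
  squared output.\<close>

lemma output_gramian:
  assumes F: "F \<in> carrier_mat n n" "stable_mat F" and G: "G \<in> carrier_mat p n"
  obtains P where "P \<in> carrier_mat n n" "P\<^sup>T = P"
    "\<And>v. v \<in> carrier_vec n \<Longrightarrow> (\<lambda>t. (G *\<^sub>v (F ^\<^sub>m t *\<^sub>v v)) \<bullet> (G *\<^sub>v (F ^\<^sub>m t *\<^sub>v v))) sums (v \<bullet> (P *\<^sub>v v))"
    "\<And>v. v \<in> carrier_vec n \<Longrightarrow> v \<bullet> (P *\<^sub>v v) = (G *\<^sub>v v) \<bullet> (G *\<^sub>v v) + (F *\<^sub>v v) \<bullet> (P *\<^sub>v (F *\<^sub>v v))"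
    "\<And>v. v \<in> carrier_vec n \<Longrightarrow> 0 \<le> v \<bullet> (P *\<^sub>v v)"
proof -
  have S: "G\<^sup>T * G \<in> carrier_mat n n" "(G\<^sup>T * G)\<^sup>T = G\<^sup>T * G"
    using G transpose_mult[of "G\<^sup>T" n p G n] by (auto simp del: transpose_mat_eq)
  obtain P where P: "P \<in> carrier_mat n n" "P\<^sup>T = P"
    "\<And>v. v \<in> carrier_vec n \<Longrightarrow> (\<lambda>t. (F ^\<^sub>m t *\<^sub>v v) \<bullet> ((G\<^sup>T * G) *\<^sub>v (F ^\<^sub>m t *\<^sub>v v))) sums (v \<bullet> (P *\<^sub>v v))"
    "\<And>v. v \<in> carrier_vec n \<Longrightarrow> v \<bullet> (P *\<^sub>v v) = v \<bullet> ((G\<^sup>T * G) *\<^sub>v v) + (F *\<^sub>v v) \<bullet> (P *\<^sub>v (F *\<^sub>v v))"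
    by (rule discrete_lyapunov_solution[OF F S]) (rule that)
  have Ftv: "F ^\<^sub>m t *\<^sub>v v \<in> carrier_vec n" if "v \<in> carrier_vec n" for t v
    using pow_carrier_mat[OF F(1)] that by (rule mult_mat_vec_carrier)
  have sums: "(\<lambda>t. (G *\<^sub>v (F ^\<^sub>m t *\<^sub>v v)) \<bullet> (G *\<^sub>v (F ^\<^sub>m t *\<^sub>v v))) sums (v \<bullet> (P *\<^sub>v v))" if "v \<in> carrier_vec n" for v
    using P(3)[OF that] unfolding gram_form[OF G Ftv[OF that]] .
  show ?thesis
  proof (rule that[OF P(1,2) sums])
    fix v :: "real vec" assume v: "v \<in> carrier_vec n"
    show "v \<bullet> (P *\<^sub>v v) = (G *\<^sub>v v) \<bullet> (G *\<^sub>v v) + (F *\<^sub>v v) \<bullet> (P *\<^sub>v (F *\<^sub>v v))"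
      using P(4)[OF v] unfolding gram_form[OF G v] .
    show "0 \<le> v \<bullet> (P *\<^sub>v v)"
      by (rule sums_le[OF _ sums_zero sums[OF v]]) (simp add: scalar_prod_def sum_nonneg)
  qed
qed

lemma quad_add_smult:
  assumes "P \<in> carrier_mat n n" "S \<in> carrier_mat n n" "v \<in> carrier_vec n"
  shows "v \<bullet> ((P + c \<cdot>\<^sub>m S) *\<^sub>v v) = v \<bullet> (P *\<^sub>v v) + c * (v \<bullet> (S *\<^sub>v (v :: real vec)))"
proof -
  have "(P + c \<cdot>\<^sub>m S) *\<^sub>v v = P *\<^sub>v v + c \<cdot>\<^sub>v (S *\<^sub>v v)"
    using assms by (auto intro!: eq_vecI simp: add_scalar_prod_distrib[of _ n])
  moreover have "P *\<^sub>v v \<in> carrier_vec n" "S *\<^sub>v v \<in> carrier_vec n" using assms by auto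
  ultimately show ?thesis using assms(3) by (simp add: scalar_prod_add_distrib[of _ n])
qed

subsection \<open>Explaining systems\<close>

definition outer_prod :: "real vec \<Rightarrow> real vec \<Rightarrow> real mat" where
  "outer_prod g v = mat (dim_vec g) (dim_vec v) (\<lambda>(i,j). g $ i * v $ j)"

lemma outer_prod_carrier [simp]:
  "g \<in> carrier_vec n \<Longrightarrow> v \<in> carrier_vec k \<Longrightarrow> outer_prod g v \<in> carrier_mat n k"
  by (auto simp: outer_prod_def)

lemma outer_prod_mult:
  assumes "v \<in> carrier_vec k" "M \<in> carrier_mat k r"
  shows "outer_prod g v * M = outer_prod g (M\<^sup>T *\<^sub>v v)"
  using assms by (intro eq_matI)
    (auto simp: outer_prod_def scalar_prod_def sum_distrib_left mult.commute mult.left_commute)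

lemma outer_prod_add:
  assumes "v \<in> carrier_vec k" "w \<in> carrier_vec k"
  shows "outer_prod g v + outer_prod g w = outer_prod g (v + w)"
  using assms by (intro eq_matI) (auto simp: outer_prod_def algebra_simps)

lemma mat_trace_add:
  assumes "M \<in> carrier_mat n n" "N \<in> carrier_mat n n"
  shows "mat_trace (M + N) = mat_trace M + mat_trace (N :: real mat)"
  using assms by (auto simp: mat_trace_def sum.distrib)

lemma mat_trace_outer_prod:
  assumes "g \<in> carrier_vec n" "v \<in> carrier_vec n"
  shows "mat_trace (outer_prod g v) = g \<bullet> v"
  using assms by (auto simp: mat_trace_def outer_prod_def scalar_prod_def lessThan_atLeast0)

lemma append_rows_mult_eq_zero_iff:
  fixes W Z M :: "'a :: semiring_0 mat"
  assumes "W \<in> carrier_mat d k" "Z \<in> carrier_mat p k" "M \<in> carrier_mat k n"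
  shows "(W @\<^sub>r Z) * M = 0\<^sub>m (d + p) n \<longleftrightarrow> W * M = 0\<^sub>m d n \<and> Z * M = 0\<^sub>m p n"
proof -
  have entry: "((W @\<^sub>r Z) * M) $$ (i,j) = (if i < d then (W * M) $$ (i,j) else (Z * M) $$ (i - d, j))"
    if "i < d + p" "j < n" for i j
    using that assms by (auto simp: append_rows_def scalar_prod_def)
  have WZ: "(W @\<^sub>r Z) * M \<in> carrier_mat (d + p) n"
    by (rule mult_carrier_mat[OF carrier_append_rows[OF assms(1,2)] assms(3)])
  show ?thesis
  proof
    assume z: "(W @\<^sub>r Z) * M = 0\<^sub>m (d + p) n"
    have "(W * M) $$ (i,j) = 0" if "i < d" "j < n" for i j
      using entry[of i j] that unfolding z by simp
    moreover have "(Z * M) $$ (i,j) = 0" if "i < p" "j < n" for i j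
      using entry[of "d + i" j] that unfolding z by simp
    ultimately show "W * M = 0\<^sub>m d n \<and> Z * M = 0\<^sub>m p n"
      using assms by (auto intro!: eq_matI simp del: index_mult_mat(1))
  next
    assume "W * M = 0\<^sub>m d n \<and> Z * M = 0\<^sub>m p n"
    thus "(W @\<^sub>r Z) * M = 0\<^sub>m (d + p) n" using entry WZ by (intro eq_matI) auto
  qed
qed

text \<open>Only dimensions are fixed here; that some system explains the data enters the lemmas as
  a hypothesis. \<open>X\<close> has \<open>T + 1\<close> columns, so its two shifted parts have
  \<open>T\<close>.\<close>

locale data_driven =
  fixes n m d p T :: nat and C D U W X :: "real mat"
  assumes C: "C \<in> carrier_mat p n" and D: "D \<in> carrier_mat p m"
    and U: "U \<in> carrier_mat m T" and W: "W \<in> carrier_mat d T" and X: "X \<in> carrier_mat n (T + 1)"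
begin

abbreviation "Xm \<equiv> past_cols X"
abbreviation "Xp \<equiv> future_cols X"
abbreviation "Z \<equiv> output_data C D U X"

lemma Xm: "Xm \<in> carrier_mat n T" and Xp: "Xp \<in> carrier_mat n T"
  using X by (auto simp: past_cols_def future_cols_def)

lemma Z: "Z \<in> carrier_mat p T"
  using C D U Xm by (auto simp: output_data_def)

lemma explaining_iff:
  "(A, B, E) \<in> explaining_systems U W X \<longleftrightarrow> A \<in> carrier_mat n n \<and> B \<in> carrier_mat n m \<and> E \<in> carrier_mat n d
    \<and> Xp = A * Xm + B * U + E * W"
  using X U W by (auto simp: explaining_systems_def)

text \<open>The added terms contribute \<open>g\<close> times the transposed kernel combination,
  which is zero, to the data equation.\<close>

lemma explaining_perturb:
  assumes "(A, B, E) \<in> explaining_systems U W X"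
    and v: "\<xi> \<in> carrier_vec n" "\<eta> \<in> carrier_vec m" "\<zeta> \<in> carrier_vec d" and g: "g \<in> carrier_vec n"
    and ker: "Xm\<^sup>T *\<^sub>v \<xi> + U\<^sup>T *\<^sub>v \<eta> + W\<^sup>T *\<^sub>v \<zeta> = 0\<^sub>v T"
  shows "(A + outer_prod g \<xi>, B + outer_prod g \<eta>, E + outer_prod g \<zeta>) \<in> explaining_systems U W X"
proof -
  have A: "A \<in> carrier_mat n n" and B: "B \<in> carrier_mat n m" and E: "E \<in> carrier_mat n d"
    and eq: "Xp = A * Xm + B * U + E * W" using assms(1) by (auto simp: explaining_iff)
  note o = outer_prod_carrier[OF g v(1)] outer_prod_carrier[OF g v(2)] outer_prod_carrier[OF g v(3)]
  note c = Xm[THEN transpose_carrier_mat[THEN iffD2]] U[THEN transpose_carrier_mat[THEN iffD2]]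
    W[THEN transpose_carrier_mat[THEN iffD2]]
  note cv = mult_mat_vec_carrier[OF c(1) v(1)] mult_mat_vec_carrier[OF c(2) v(2)] mult_mat_vec_carrier[OF c(3) v(3)]
  have "outer_prod g \<xi> * Xm + outer_prod g \<eta> * U + outer_prod g \<zeta> * W = outer_prod g (0\<^sub>v T)"
    unfolding ker[symmetric] outer_prod_mult[OF v(1) Xm] outer_prod_mult[OF v(2) U] outer_prod_mult[OF v(3) W]
    using cv by (simp add: outer_prod_add[of _ T])
  also have "\<dots> = 0\<^sub>m n T" using g by (auto simp: outer_prod_def)
  finally have z: "outer_prod g \<xi> * Xm + outer_prod g \<eta> * U + outer_prod g \<zeta> * W = 0\<^sub>m n T" .
  have "(A + outer_prod g \<xi>) * Xm + (B + outer_prod g \<eta>) * U + (E + outer_prod g \<zeta>) * W =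
    (A * Xm + outer_prod g \<xi> * Xm) + (B * U + outer_prod g \<eta> * U) + (E * W + outer_prod g \<zeta> * W)"
    using add_mult_distrib_mat[OF A o(1) Xm] add_mult_distrib_mat[OF B o(2) U] add_mult_distrib_mat[OF E o(3) W] by simp
  also have "\<dots> = (A * Xm + B * U + E * W) + (outer_prod g \<xi> * Xm + outer_prod g \<eta> * U + outer_prod g \<zeta> * W)"
    using A B E o Xm U W by (intro eq_matI) auto
  also have "\<dots> = Xp" unfolding z eq[symmetric] using Xp by simp
  finally show ?thesis using A B E o by (auto simp: explaining_iff)
qed

lemma closed_loop_perturb:
  assumes A: "A \<in> carrier_mat n n" "B \<in> carrier_mat n m" and K: "K \<in> carrier_mat m n"
    and v: "\<xi> \<in> carrier_vec n" "\<eta> \<in> carrier_vec m" and g: "g \<in> carrier_vec n"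
  shows "(A + outer_prod g \<xi>) + (B + outer_prod g \<eta>) * K = (A + B * K) + outer_prod g (\<xi> + K\<^sup>T *\<^sub>v \<eta>)"
proof -
  have "K\<^sup>T *\<^sub>v \<eta> \<in> carrier_vec n" using K v by auto
  hence "outer_prod g (\<xi> + K\<^sup>T *\<^sub>v \<eta>) = outer_prod g \<xi> + outer_prod g \<eta> * K"
    using v by (simp add: outer_prod_mult[OF v(2) K] outer_prod_add[of _ n])
  moreover have "(B + outer_prod g \<eta>) * K = B * K + outer_prod g \<eta> * K"
    using A K v g by (intro add_mult_distrib_mat[of _ n m]) auto
  moreover have "(A + P) + (M + N) = (A + M) + (P + N)"
    if "P \<in> carrier_mat n n" "M \<in> carrier_mat n n" "N \<in> carrier_mat n n" for P M N :: "real mat"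
    using A(1) that by (intro eq_matI) auto
  moreover have "outer_prod g \<xi> \<in> carrier_mat n n" "B * K \<in> carrier_mat n n" "outer_prod g \<eta> * K \<in> carrier_mat n n"
    using A K outer_prod_carrier[OF g v(1)] outer_prod_carrier[OF g v(2)] by auto
  ultimately show ?thesis by simp
qed

(* Perturbing along a left-kernel element moves the closed loop by s v v^T, whose trace s (v . v)
   would exceed the bound n on the trace of a stable matrix. *)
lemma stabilizing_imp_kernel:
  assumes sys: "(A, B, E) \<in> explaining_systems U W X" and K: "K \<in> carrier_mat m n"
    and st: "\<And>A B E. (A, B, E) \<in> explaining_systems U W X \<Longrightarrow> stable_mat (A + B * K)"
    and v: "\<xi> \<in> carrier_vec n" "\<eta> \<in> carrier_vec m" "\<zeta> \<in> carrier_vec d"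
    and ker: "Xm\<^sup>T *\<^sub>v \<xi> + U\<^sup>T *\<^sub>v \<eta> + W\<^sup>T *\<^sub>v \<zeta> = 0\<^sub>v T"
  shows "\<xi> + K\<^sup>T *\<^sub>v \<eta> = 0\<^sub>v n"
proof (rule ccontr)
  define g where "g = \<xi> + K\<^sup>T *\<^sub>v \<eta>"
  assume "\<not> ?thesis"
  hence g0: "g \<noteq> 0\<^sub>v n" by (simp add: g_def)
  have g: "g \<in> carrier_vec n" unfolding g_def using K v by auto
  have A: "A \<in> carrier_mat n n" "B \<in> carrier_mat n m" using sys by (auto simp: explaining_iff)
  have F: "A + B * K \<in> carrier_mat n n" using A K by auto
  have "\<bar>mat_trace (A + B * K) + s * (g \<bullet> g)\<bar> \<le> n" for s
  proof -
    have sg: "s \<cdot>\<^sub>v g \<in> carrier_vec n" using g by simp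
    have o: "outer_prod (s \<cdot>\<^sub>v g) g \<in> carrier_mat n n" using sg g by simp
    have "stable_mat ((A + B * K) + outer_prod (s \<cdot>\<^sub>v g) g)"
      using st[OF explaining_perturb[OF sys v sg ker]] unfolding closed_loop_perturb[OF A K v(1,2) sg] g_def[symmetric] .
    hence "\<bar>mat_trace ((A + B * K) + outer_prod (s \<cdot>\<^sub>v g) g)\<bar> \<le> n"
      using F o by (intro abs_trace_stable_le) auto
    thus ?thesis using g sg by (simp add: mat_trace_add[OF F o] mat_trace_outer_prod[of _ n])
  qed
  hence "g \<bullet> g = 0" by (rule affine_bounded_imp_zero)
  thus False using scalar_prod_self_pos[OF g g0] by simp
qed

text \<open>Multiplying the data equation on the right by \<open>\<Psi>\<close> leaves
  \<open>A + B * (U * \<Psi>)\<close> and removes the disturbance, so all explaining systems share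
  one closed loop.\<close>

lemma closed_loop_eq:
  assumes \<Psi>: "\<Psi> \<in> carrier_mat T n" and XPsi: "Xm * \<Psi> = 1\<^sub>m n" and WPsi: "W * \<Psi> = 0\<^sub>m d n"
  shows "(A, B, E) \<in> explaining_systems U W X \<Longrightarrow> A + B * (U * \<Psi>) = Xp * \<Psi>"
    and "C + D * (U * \<Psi>) = Z * \<Psi>"
proof -
  assume "(A, B, E) \<in> explaining_systems U W X"
  hence A: "A \<in> carrier_mat n n" and B: "B \<in> carrier_mat n m" and E: "E \<in> carrier_mat n d"
    and eq: "Xp = A * Xm + B * U + E * W" by (auto simp: explaining_iff)
  have "Xp * \<Psi> = A * Xm * \<Psi> + B * U * \<Psi> + E * W * \<Psi>"
    unfolding eq using A B E Xm U W \<Psi> by (simp add: add_mult_distrib_mat[of _ n T])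
  also have "A * Xm * \<Psi> = A" using assoc_mult_mat[OF A Xm \<Psi>] XPsi A by simp
  also have "E * W * \<Psi> = 0\<^sub>m n n" using assoc_mult_mat[OF E W \<Psi>] WPsi E by simp
  also have "B * U * \<Psi> = B * (U * \<Psi>)" by (rule assoc_mult_mat[OF B U \<Psi>])
  also have "A + B * (U * \<Psi>) + 0\<^sub>m n n = A + B * (U * \<Psi>)" using A B U \<Psi> by (intro right_add_zero_mat) auto
  finally show "A + B * (U * \<Psi>) = Xp * \<Psi>" ..
next
  have "Z * \<Psi> = C * Xm * \<Psi> + D * U * \<Psi>"
    unfolding output_data_def using C D Xm U \<Psi> by (simp add: add_mult_distrib_mat[of _ p T])
  also have "C * Xm * \<Psi> = C" using assoc_mult_mat[OF C Xm \<Psi>] XPsi C by simp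
  also have "D * U * \<Psi> = D * (U * \<Psi>)" by (rule assoc_mult_mat[OF D U \<Psi>])
  finally show "C + D * (U * \<Psi>) = Z * \<Psi>" ..
qed

section \<open>Conditions (i) and (ii) and the gain they encode\<close>

text \<open>Gathers products of transposes into \<open>(Xp * \<Theta>)\<^sup>T\<close>, the shape
  that the Schur complement lemmas expect; the next lemma does the same for (ii).\<close>

lemma cond_i_iff:
  assumes \<Theta>: "\<Theta> \<in> carrier_mat T n"
  shows "cond_i C D U W X \<Theta> \<longleftrightarrow> (Xm * \<Theta>)\<^sup>T = Xm * \<Theta> \<and> W * \<Theta> = 0\<^sub>m d n \<and> Z * \<Theta> = 0\<^sub>m p n \<and>
    pos_def_mat (four_block_mat (Xm * \<Theta>) (Xp * \<Theta>)\<^sup>T (Xp * \<Theta>) (Xm * \<Theta>))"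
  using \<Theta> X C U W Xm append_rows_mult_eq_zero_iff[OF W Z \<Theta>] transpose_mult[OF Xp \<Theta>]
  by (auto simp: cond_i_def Let_def eq_commute[of "Xm * \<Theta>"])

lemma cond_ii_iff:
  assumes \<Theta>: "\<Theta> \<in> carrier_mat T n" and Wi: "Wi \<in> carrier_mat T d"
  shows "cond_ii \<gamma> C D U W X Wi Y \<Theta> \<longleftrightarrow> W * Wi = 1\<^sub>m d \<and> Y \<in> carrier_mat d d \<and> Y\<^sup>T = Y \<and>
     (Xm * \<Theta>)\<^sup>T = Xm * \<Theta> \<and> W * \<Theta> = 0\<^sub>m d n \<and> Xm * Wi = 0\<^sub>m n d \<and> U * Wi = 0\<^sub>m m d \<and>
     pos_def_mat (three_block_mat (Xm * \<Theta>) (Xp * \<Theta>)\<^sup>T (Z * \<Theta>)\<^sup>T (Xp * \<Theta>) (Xm * \<Theta>) (0\<^sub>m n p)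
       (Z * \<Theta>) (0\<^sub>m p n) (1\<^sub>m p)) \<and>
     pos_def_mat (four_block_mat Y (Xp * Wi)\<^sup>T (Xp * Wi) (Xm * \<Theta>)) \<and> mat_trace Y < \<gamma>"
  using \<Theta> Wi X C U W Xm transpose_mult[OF Xp \<Theta>] transpose_mult[OF Z \<Theta>] transpose_mult[OF Xp Wi]
  by (auto simp: cond_ii_def Let_def eq_commute[of "Xm * \<Theta>"] eq_commute[of Y] right_inverse_mat_def inverts_mat_def)

text \<open>Positive definiteness ensures that \<open>mat_inverse\<close> yields an inverse; by
  uniqueness it is the given right inverse \<open>R\<close>.\<close>

lemma data_gain_eq:
  assumes \<Theta>: "\<Theta> \<in> carrier_mat T n" and pd: "pos_def_mat (Xm * \<Theta>)"
    and R: "R \<in> carrier_mat n n" "Xm * \<Theta> * R = 1\<^sub>m n"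
  shows "data_gain U X \<Theta> = U * (\<Theta> * R)"
proof -
  have Q: "Xm * \<Theta> \<in> carrier_mat n n" using Xm \<Theta> by auto
  obtain R' where R': "mat_inverse (Xm * \<Theta>) = Some R'" "R' \<in> carrier_mat n n" "R' * (Xm * \<Theta>) = 1\<^sub>m n"
    using pos_def_inverse[OF pd Q] by metis
  have "R' = R' * (Xm * \<Theta> * R)" using R R' by simp
  also have "\<dots> = R' * (Xm * \<Theta>) * R" by (rule assoc_mult_mat[symmetric, OF R'(2) Q R(1)])
  also have "\<dots> = R" using R R' by simp
  finally show ?thesis unfolding data_gain_def R'(1) using assoc_mult_mat[OF U \<Theta> R(1)] by simp
qed

text \<open>Passing from \<open>\<Psi>\<close> to \<open>\<Psi> * Q\<close> turns the normalisation
  \<open>Xm * \<Psi> = 1\<^sub>m n\<close> into an arbitrary positive definite \<open>Q\<close>,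
  while the encoded gain stays \<open>U * \<Psi>\<close>.\<close>

lemma scaled_kernel_solution:
  assumes \<Psi>: "\<Psi> \<in> carrier_mat T n" "Xm * \<Psi> = 1\<^sub>m n" "W * \<Psi> = 0\<^sub>m d n"
    and Q: "Q \<in> carrier_mat n n" "pos_def_mat Q" and R: "R \<in> carrier_mat n n" "Q * R = 1\<^sub>m n"
  shows "Xm * (\<Psi> * Q) = Q" "W * (\<Psi> * Q) = 0\<^sub>m d n" "Xp * (\<Psi> * Q) = (Xp * \<Psi>) * Q" "Z * (\<Psi> * Q) = (Z * \<Psi>) * Q"
    "data_gain U X (\<Psi> * Q) = U * \<Psi>"
proof -
  show XQ: "Xm * (\<Psi> * Q) = Q" using assoc_mult_mat[OF Xm \<Psi>(1) Q(1)] \<Psi>(2) Q by simp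
  show "W * (\<Psi> * Q) = 0\<^sub>m d n" using assoc_mult_mat[OF W \<Psi>(1) Q(1)] \<Psi>(3) Q by simp
  show "Xp * (\<Psi> * Q) = (Xp * \<Psi>) * Q" using assoc_mult_mat[OF Xp \<Psi>(1) Q(1)] by simp
  show "Z * (\<Psi> * Q) = (Z * \<Psi>) * Q" using assoc_mult_mat[OF Z \<Psi>(1) Q(1)] by simp
  have "\<Psi> * Q * R = \<Psi>" using assoc_mult_mat[OF \<Psi>(1) Q(1) R(1)] R \<Psi> by simp
  thus "data_gain U X (\<Psi> * Q) = U * \<Psi>"
    using data_gain_eq[of "\<Psi> * Q" R] \<Psi>(1) Q R XQ by simp
qed

section \<open>Necessity: from a suboptimal gain to the conditions\<close>

text \<open>With zero output it remains to certify stability: the Lyapunov equation with identity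
  weight is solved by some \<open>R\<close>, and \<open>\<Theta> = \<Psi> * Q\<close> for the
  inverse \<open>Q\<close> of \<open>R\<close>.\<close>

lemma suboptimal_imp_cond_i:
  assumes \<Psi>: "\<Psi> \<in> carrier_mat T n" "Xm * \<Psi> = 1\<^sub>m n" "W * \<Psi> = 0\<^sub>m d n"
    and st: "stable_mat (Xp * \<Psi>)" and G0: "Z * \<Psi> = 0\<^sub>m p n"
  shows "\<exists>\<Theta>. cond_i C D U W X \<Theta> \<and> U * \<Psi> = data_gain U X \<Theta>"
proof -
  define F where "F = Xp * \<Psi>"
  have F: "F \<in> carrier_mat n n" using Xp \<Psi> by (auto simp: F_def)
  obtain R where R: "R \<in> carrier_mat n n" "R\<^sup>T = R"
    and sums: "\<And>v. v \<in> carrier_vec n \<Longrightarrow> (\<lambda>t. (F ^\<^sub>m t *\<^sub>v v) \<bullet> (1\<^sub>m n *\<^sub>v (F ^\<^sub>m t *\<^sub>v v))) sums (v \<bullet> (R *\<^sub>v v))"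
    and lyap: "\<And>v. v \<in> carrier_vec n \<Longrightarrow> v \<bullet> (R *\<^sub>v v) = v \<bullet> (1\<^sub>m n *\<^sub>v v) + (F *\<^sub>v v) \<bullet> (R *\<^sub>v (F *\<^sub>v v))"
    by (rule discrete_lyapunov_solution[OF F st[folded F_def] one_carrier_mat transpose_one]) (rule that)
  have Ftv: "F ^\<^sub>m t *\<^sub>v v \<in> carrier_vec n" if "v \<in> carrier_vec n" for t v
    using pow_carrier_mat[OF F] that by (rule mult_mat_vec_carrier)
  have nonneg: "0 \<le> v \<bullet> (R *\<^sub>v v)" if v: "v \<in> carrier_vec n" for v
    by (rule sums_le[OF _ sums_zero sums[OF v]])
      (use Ftv[OF v] in \<open>simp add: scalar_prod_def sum_nonneg\<close>)
  have dec: "(F *\<^sub>v v) \<bullet> (R *\<^sub>v (F *\<^sub>v v)) < v \<bullet> (R *\<^sub>v v)" if "v \<in> carrier_vec n" "v \<noteq> 0\<^sub>v n" for v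
    using lyap[OF that(1)] scalar_prod_self_pos[OF that] that(1) by simp
  have Fv: "F *\<^sub>v v \<in> carrier_vec n" if "v \<in> carrier_vec n" for v using F that by auto
  \<comment> \<open>For nonzero \<open>v\<close> the form of \<open>R\<close> at \<open>v\<close>
    exceeds the form at \<open>F *\<^sub>v v\<close>, which is nonnegative.\<close>
  have pd: "pos_def_mat R"
    using dec nonneg[OF Fv] by (intro pos_def_matI[OF R]) (meson le_less_trans)
  obtain Q where Q: "Q \<in> carrier_mat n n" "R * Q = 1\<^sub>m n" "Q * R = 1\<^sub>m n" "pos_def_mat Q"
    using pos_def_inverse[OF pd R(1)] by metis
  note s = scaled_kernel_solution[OF \<Psi> Q(1,4) R(1) Q(3)]
  have \<Theta>: "\<Psi> * Q \<in> carrier_mat T n" using \<Psi> Q by auto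
  have "pos_def_mat (four_block_mat Q (F * Q)\<^sup>T (F * Q) Q)"
    using pos_def_lyapunov_block_iff[OF Q(1,4) R(1) Q(3,2) F] dec by blast
  hence "cond_i C D U W X (\<Psi> * Q)"
    unfolding cond_i_iff[OF \<Theta>] s F_def[symmetric] G0 using pos_def_matD(1)[OF Q(4,1)] Q(1) by simp
  thus ?thesis using s(5) by metis
qed

text \<open>Right multiplication of the data equation by \<open>Wi\<close> isolates
  \<open>E\<close>, so all explaining systems share one disturbance matrix.\<close>

lemma future_mult_right_inverse:
  assumes sys: "(A, B, E) \<in> explaining_systems U W X"
    and Wi: "Wi \<in> carrier_mat T d" "Xm * Wi = 0\<^sub>m n d" "U * Wi = 0\<^sub>m m d" "W * Wi = 1\<^sub>m d"
  shows "Xp * Wi = E"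
proof -
  have A: "A \<in> carrier_mat n n" and B: "B \<in> carrier_mat n m" and E: "E \<in> carrier_mat n d"
    and eq: "Xp = A * Xm + B * U + E * W" using sys by (auto simp: explaining_iff)
  have "Xp * Wi = A * Xm * Wi + B * U * Wi + E * W * Wi"
    unfolding eq using A B E Xm U W Wi(1) by (simp add: add_mult_distrib_mat[of _ n T])
  also have "A * Xm * Wi = 0\<^sub>m n d" using assoc_mult_mat[OF A Xm Wi(1)] Wi A by simp
  also have "B * U * Wi = 0\<^sub>m n d" using assoc_mult_mat[OF B U Wi(1)] Wi B by simp
  also have "E * W * Wi = E" using assoc_mult_mat[OF E W Wi(1)] Wi E by simp
  finally show ?thesis using E by simp
qed

text \<open>The observability Gramian \<open>P\<close> meets the Lyapunov relation with equality,
  and its form summed over the columns of \<open>E\<close> is the cost \<open>J\<close>. The slack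
  \<open>\<gamma> - J\<close> pays for strictness: \<open>R\<close> is \<open>P\<close> plus a small
  multiple of the Gramian \<open>S\<close> with identity weight, and \<open>Y\<close> is
  \<open>E\<^sup>T * (R * E)\<close> plus a small multiple of the identity.\<close>

lemma suboptimal_imp_cond_ii:
  assumes sys: "(A, B, E) \<in> explaining_systems U W X"
    and \<Psi>: "\<Psi> \<in> carrier_mat T n" "Xm * \<Psi> = 1\<^sub>m n" "W * \<Psi> = 0\<^sub>m d n"
    and st: "stable_mat (Xp * \<Psi>)"
    and Wi: "Wi \<in> carrier_mat T d" "Xm * Wi = 0\<^sub>m n d" "U * Wi = 0\<^sub>m m d" "W * Wi = 1\<^sub>m d"
    and cost: "H2_cost C D A B E (U * \<Psi>) < \<gamma>"
  shows "\<exists>\<Theta> Y. cond_ii \<gamma> C D U W X Wi Y \<Theta> \<and> U * \<Psi> = data_gain U X \<Theta>"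
proof -
  have A: "A \<in> carrier_mat n n" and B: "B \<in> carrier_mat n m" and E: "E \<in> carrier_mat n d"
    using sys by (auto simp: explaining_iff)
  have XpWi: "Xp * Wi = E" by (rule future_mult_right_inverse[OF sys Wi])
  define F where "F = Xp * \<Psi>"
  define G where "G = Z * \<Psi>"
  have F: "F \<in> carrier_mat n n" using Xp \<Psi> by (auto simp: F_def)
  have G: "G \<in> carrier_mat p n" using Z \<Psi> by (auto simp: G_def)
  note st = st[folded F_def]
  note cl = closed_loop_eq[OF \<Psi>, folded F_def G_def]
  have K: "U * \<Psi> \<in> carrier_mat m n" using U \<Psi> by auto
  obtain P where P: "P \<in> carrier_mat n n" "P\<^sup>T = P"
    and Psums: "\<And>v. v \<in> carrier_vec n \<Longrightarrow> (\<lambda>t. (G *\<^sub>v (F ^\<^sub>m t *\<^sub>v v)) \<bullet> (G *\<^sub>v (F ^\<^sub>m t *\<^sub>v v))) sums (v \<bullet> (P *\<^sub>v v))"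
    and Plyap: "\<And>v. v \<in> carrier_vec n \<Longrightarrow> v \<bullet> (P *\<^sub>v v) = (G *\<^sub>v v) \<bullet> (G *\<^sub>v v) + (F *\<^sub>v v) \<bullet> (P *\<^sub>v (F *\<^sub>v v))"
    and Pnonneg: "\<And>v. v \<in> carrier_vec n \<Longrightarrow> 0 \<le> v \<bullet> (P *\<^sub>v v)"
    by (rule output_gramian[OF F st G]) (rule that)
  obtain S where S: "S \<in> carrier_mat n n" "S\<^sup>T = S"
    and Ssums: "\<And>v. v \<in> carrier_vec n \<Longrightarrow> (\<lambda>t. (F ^\<^sub>m t *\<^sub>v v) \<bullet> (1\<^sub>m n *\<^sub>v (F ^\<^sub>m t *\<^sub>v v))) sums (v \<bullet> (S *\<^sub>v v))"
    and Slyap: "\<And>v. v \<in> carrier_vec n \<Longrightarrow> v \<bullet> (S *\<^sub>v v) = v \<bullet> (1\<^sub>m n *\<^sub>v v) + (F *\<^sub>v v) \<bullet> (S *\<^sub>v (F *\<^sub>v v))"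
    by (rule discrete_lyapunov_solution[OF F st one_carrier_mat transpose_one]) (rule that)
  have Ftv: "F ^\<^sub>m t *\<^sub>v v \<in> carrier_vec n" if "v \<in> carrier_vec n" for t v
    using pow_carrier_mat[OF F] that by (rule mult_mat_vec_carrier)
  have Fv: "F *\<^sub>v v \<in> carrier_vec n" if "v \<in> carrier_vec n" for v using F that by auto
  have Snonneg: "0 \<le> v \<bullet> (S *\<^sub>v v)" if v: "v \<in> carrier_vec n" for v
    by (rule sums_le[OF _ sums_zero Ssums[OF v]])
      (use Ftv[OF v] in \<open>simp add: scalar_prod_def sum_nonneg\<close>)
  have e: "col E j \<in> carrier_vec n" if "j < d" for j using E that by auto
  define J where "J = (\<Sum>j<d. col E j \<bullet> (P *\<^sub>v col E j))"
  define c where "c = (\<Sum>j<d. col E j \<bullet> (S *\<^sub>v col E j))"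
  have "(\<lambda>t. \<Sum>j<d. (G *\<^sub>v (F ^\<^sub>m t *\<^sub>v col E j)) \<bullet> (G *\<^sub>v (F ^\<^sub>m t *\<^sub>v col E j))) sums J"
    unfolding J_def by (intro sums_sum Psums e) auto
  hence "H2_cost C D A B E (U * \<Psi>) = J"
    unfolding H2_cost_def trace_closed_loop_response[OF C D K A B E] cl(1)[OF sys] cl(2) by (rule sums_unique[symmetric])
  with cost have J: "J < \<gamma>" by simp
  have c: "c \<ge> 0" unfolding c_def by (intro sum_nonneg Snonneg e) auto
  \<comment> \<open>The trace of \<open>Y\<close> will exceed \<open>J\<close> by
    \<open>\<delta> * (c + d)\<close>; the extra \<open>+ 1\<close> keeps this strictly below
    \<open>\<gamma> - J\<close> and the divisor positive.\<close>
  define \<delta> where "\<delta> = (\<gamma> - J) / (c + d + 1)"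
  have \<delta>: "\<delta> > 0" unfolding \<delta>_def using J c by (intro divide_pos_pos) auto
  have "\<delta> * (c + d + 1) = \<gamma> - J" unfolding \<delta>_def using c by simp
  hence bound: "J + \<delta> * c + \<delta> * d < \<gamma>" using \<delta> by (simp add: algebra_simps)
  define R where "R = P + \<delta> \<cdot>\<^sub>m S"
  have R: "R \<in> carrier_mat n n" using P S by (auto simp: R_def)
  have Rt: "R\<^sup>T = R" using P S by (auto simp: R_def transpose_add[of _ n n] transpose_smult_mat)
  have Rq: "v \<bullet> (R *\<^sub>v v) = v \<bullet> (P *\<^sub>v v) + \<delta> * (v \<bullet> (S *\<^sub>v v))" if "v \<in> carrier_vec n" for v
    unfolding R_def by (rule quad_add_smult[OF P(1) S(1) that])
  have dec: "(F *\<^sub>v v) \<bullet> (R *\<^sub>v (F *\<^sub>v v)) + (G *\<^sub>v v) \<bullet> (G *\<^sub>v v) < v \<bullet> (R *\<^sub>v v)"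
    if v: "v \<in> carrier_vec n" "v \<noteq> 0\<^sub>v n" for v
  proof -
    have "v \<bullet> (R *\<^sub>v v) = (F *\<^sub>v v) \<bullet> (R *\<^sub>v (F *\<^sub>v v)) + (G *\<^sub>v v) \<bullet> (G *\<^sub>v v) + \<delta> * (v \<bullet> v)"
      using Plyap[OF v(1)] Slyap[OF v(1)] Rq[OF v(1)] Rq[OF Fv[OF v(1)]] v(1) by (simp add: algebra_simps)
    thus ?thesis using \<delta> scalar_prod_self_pos[OF v] by simp
  qed
  have Rnonneg: "v \<bullet> (R *\<^sub>v v) \<ge> 0" if "v \<in> carrier_vec n" for v
    using Rq[OF that] Pnonneg[OF that] Snonneg[OF that] \<delta> by simp
  have pd: "pos_def_mat R"
  proof (rule pos_def_matI[OF R Rt])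
    fix v :: "real vec" assume v: "v \<in> carrier_vec n" "v \<noteq> 0\<^sub>v n"
    have "0 \<le> (G *\<^sub>v v) \<bullet> (G *\<^sub>v v)" by (simp add: scalar_prod_def sum_nonneg)
    thus "0 < v \<bullet> (R *\<^sub>v v)" using dec[OF v] Rnonneg[OF Fv[OF v(1)]] by linarith
  qed
  obtain Q where Q: "Q \<in> carrier_mat n n" "R * Q = 1\<^sub>m n" "Q * R = 1\<^sub>m n" "pos_def_mat Q"
    using pos_def_inverse[OF pd R] by metis
  note s = scaled_kernel_solution[OF \<Psi> Q(1,4) R Q(3)]
  have \<Theta>: "\<Psi> * Q \<in> carrier_mat T n" using \<Psi> Q by auto
  have three: "pos_def_mat (three_block_mat Q (F * Q)\<^sup>T (G * Q)\<^sup>T (F * Q) Q (0\<^sub>m n p) (G * Q) (0\<^sub>m p n) (1\<^sub>m p))"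
    using pos_def_three_block_iff[OF Q(1,4) R Q(3,2) F G] dec by blast
  \<comment> \<open>\<open>H\<close> is the term that the Schur complement subtracts from
    \<open>Y\<close>, so the margin \<open>\<delta>\<close> on the diagonal makes the second block
    matrix positive definite.\<close>
  define H where "H = E\<^sup>T * (R * E)"
  define Y where "Y = H + \<delta> \<cdot>\<^sub>m 1\<^sub>m d"
  have RE: "R * E \<in> carrier_mat n d" using R E by auto
  have H: "H \<in> carrier_mat d d" using RE E by (auto simp: H_def)
  have "H\<^sup>T = (R * E)\<^sup>T * E" unfolding H_def using transpose_mult[OF _ RE, of "E\<^sup>T" d] E by simp
  also have "\<dots> = E\<^sup>T * R * E" using transpose_mult[OF R E] Rt by simp
  also have "\<dots> = H" unfolding H_def using R E by (intro assoc_mult_mat[of _ d n _ n _ d]) auto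
  finally have Ht: "H\<^sup>T = H" .
  have Y: "Y \<in> carrier_mat d d" using H by (auto simp: Y_def)
  have Yt: "Y\<^sup>T = Y" unfolding Y_def using H Ht by (auto simp: transpose_add[of _ d d] transpose_smult_mat)
  have Hq: "x \<bullet> (H *\<^sub>v x) = (E *\<^sub>v x) \<bullet> (R *\<^sub>v (E *\<^sub>v x))" if x: "x \<in> carrier_vec d" for x
  proof -
    have Ex: "E *\<^sub>v x \<in> carrier_vec n" using E x by auto
    have REx: "R *\<^sub>v (E *\<^sub>v x) \<in> carrier_vec n" using R Ex by auto
    have "H *\<^sub>v x = E\<^sup>T *\<^sub>v (R *\<^sub>v (E *\<^sub>v x))" unfolding H_def
      using assoc_mult_mat_vec[OF _ RE x, of "E\<^sup>T" d] assoc_mult_mat_vec[OF R E x] E by simp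
    moreover have "E\<^sup>T *\<^sub>v (R *\<^sub>v (E *\<^sub>v x)) \<in> carrier_vec d" using E REx by auto
    ultimately show ?thesis
      using transpose_vec_mult_scalar[OF E x REx] x REx Ex comm_scalar_prod[of x d] comm_scalar_prod[OF REx Ex] by simp
  qed
  have four: "pos_def_mat (four_block_mat Y E\<^sup>T E Q)"
    unfolding pos_def_block_iff[OF Y Yt E Q(1,4) R Q(3)]
  proof (intro ballI impI)
    fix x :: "real vec" assume x: "x \<in> carrier_vec d" "x \<noteq> 0\<^sub>v d"
    have Yx: "Y *\<^sub>v x = H *\<^sub>v x + \<delta> \<cdot>\<^sub>v x"
      unfolding Y_def using H x by (auto intro!: eq_vecI simp: add_scalar_prod_distrib[of _ d])
    have Hx: "H *\<^sub>v x \<in> carrier_vec d" using H x by auto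
    have "x \<bullet> (Y *\<^sub>v x) = (E *\<^sub>v x) \<bullet> (R *\<^sub>v (E *\<^sub>v x)) + \<delta> * (x \<bullet> x)"
      unfolding Yx using Hq[OF x(1)] x(1) Hx by (simp add: scalar_prod_add_distrib[of _ d])
    thus "(E *\<^sub>v x) \<bullet> (R *\<^sub>v (E *\<^sub>v x)) < x \<bullet> (Y *\<^sub>v x)"
      using \<delta> scalar_prod_self_pos[OF x] by simp
  qed
  \<comment> \<open>The diagonal of \<open>H\<close> splits along the two summands of
    \<open>R\<close>; summed over \<open>j\<close> the three parts give \<open>J\<close>,
    \<open>\<delta> * c\<close> and \<open>\<delta> * d\<close>.\<close>
  have Yjj: "Y $$ (j,j) = col E j \<bullet> (P *\<^sub>v col E j) + \<delta> * (col E j \<bullet> (S *\<^sub>v col E j)) + \<delta>" if j: "j < d" for j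
  proof -
    have "H $$ (j,j) = col E j \<bullet> (R *\<^sub>v col E j)"
      unfolding H_def using E RE R j by (simp add: col_mult2[OF R E j])
    thus ?thesis using H j Rq[OF e[OF j]] by (simp add: Y_def)
  qed
  have "mat_trace Y = (\<Sum>j<d. Y $$ (j,j))" using Y by (simp add: mat_trace_def)
  also have "\<dots> = J + \<delta> * c + \<delta> * d"
    by (simp add: Yjj sum.distrib J_def c_def sum_distrib_left)
  finally have "mat_trace Y < \<gamma>" using bound by simp
  hence "cond_ii \<gamma> C D U W X Wi Y (\<Psi> * Q)"
    unfolding cond_ii_iff[OF \<Theta> Wi(1)] s F_def[symmetric] G_def[symmetric] XpWi
    using pos_def_matD(1)[OF Q(4,1)] three four Wi Y Yt by simp
  thus ?thesis using s(5) by metis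
qed

text \<open>The cost is a sum of nonnegative energies over columns of \<open>E\<close> and times;
  only column \<open>j\<close> at time 0 is kept. Stability makes the series converge to the Gramian
  expression.\<close>

lemma suboptimal_output_bound:
  assumes sys: "(A, B, E) \<in> explaining_systems U W X" and K: "K \<in> carrier_mat m n"
    and st: "stable_mat (A + B * K)" and cost: "H2_cost C D A B E K < \<gamma>" and j: "j < d"
  shows "((C + D * K) *\<^sub>v col E j) \<bullet> ((C + D * K) *\<^sub>v col E j) < \<gamma>"
proof -
  have A: "A \<in> carrier_mat n n" and B: "B \<in> carrier_mat n m" and E: "E \<in> carrier_mat n d"
    using sys by (auto simp: explaining_iff)
  define F where "F = A + B * K"
  define G where "G = C + D * K"
  have F: "F \<in> carrier_mat n n" and G: "G \<in> carrier_mat p n" using A B C D K by (auto simp: F_def G_def)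
  obtain P where P: "P \<in> carrier_mat n n" "P\<^sup>T = P"
    and Psums: "\<And>v. v \<in> carrier_vec n \<Longrightarrow> (\<lambda>t. (G *\<^sub>v (F ^\<^sub>m t *\<^sub>v v)) \<bullet> (G *\<^sub>v (F ^\<^sub>m t *\<^sub>v v))) sums (v \<bullet> (P *\<^sub>v v))"
    and Plyap: "\<And>v. v \<in> carrier_vec n \<Longrightarrow> v \<bullet> (P *\<^sub>v v) = (G *\<^sub>v v) \<bullet> (G *\<^sub>v v) + (F *\<^sub>v v) \<bullet> (P *\<^sub>v (F *\<^sub>v v))"
    and Pnonneg: "\<And>v. v \<in> carrier_vec n \<Longrightarrow> 0 \<le> v \<bullet> (P *\<^sub>v v)"
    by (rule output_gramian[OF F st[folded F_def] G]) (rule that)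
  have e: "col E j \<in> carrier_vec n" if "j < d" for j using E that by auto
  have "(\<lambda>t. \<Sum>j<d. (G *\<^sub>v (F ^\<^sub>m t *\<^sub>v col E j)) \<bullet> (G *\<^sub>v (F ^\<^sub>m t *\<^sub>v col E j))) sums (\<Sum>j<d. col E j \<bullet> (P *\<^sub>v col E j))"
    by (intro sums_sum Psums e) auto
  hence "H2_cost C D A B E K = (\<Sum>j<d. col E j \<bullet> (P *\<^sub>v col E j))"
    unfolding H2_cost_def trace_closed_loop_response[OF C D K A B E] F_def[symmetric] G_def[symmetric]
    by (rule sums_unique[symmetric])
  moreover have "col E j \<bullet> (P *\<^sub>v col E j) \<le> (\<Sum>j<d. col E j \<bullet> (P *\<^sub>v col E j))"
    using j e Pnonneg by (intro member_le_sum) auto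
  moreover have "F *\<^sub>v col E j \<in> carrier_vec n" using F e[OF j] by auto
  ultimately show ?thesis
    using Plyap[OF e[OF j]] Pnonneg[of "F *\<^sub>v col E j"] cost unfolding G_def by linarith
qed

(* Perturbing E by s g zeta^T with G g nonzero would make the output at time 0 unbounded in s. *)
lemma suboptimal_imp_disturbance_kernel:
  assumes sys: "(A, B, E) \<in> explaining_systems U W X"
    and \<Psi>: "\<Psi> \<in> carrier_mat T n" "Xm * \<Psi> = 1\<^sub>m n" "W * \<Psi> = 0\<^sub>m d n"
    and sub: "H2_suboptimal_for_data \<gamma> C D U W X (U * \<Psi>)" and G0: "Z * \<Psi> \<noteq> 0\<^sub>m p n"
    and v: "\<xi> \<in> carrier_vec n" "\<eta> \<in> carrier_vec m" "\<zeta> \<in> carrier_vec d"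
    and ker: "Xm\<^sup>T *\<^sub>v \<xi> + U\<^sup>T *\<^sub>v \<eta> + W\<^sup>T *\<^sub>v \<zeta> = 0\<^sub>v T"
  shows "\<zeta> = 0\<^sub>v d"
proof -
  have E: "E \<in> carrier_mat n d" using sys by (auto simp: explaining_iff)
  define G where "G = Z * \<Psi>"
  have G: "G \<in> carrier_mat p n" using Z \<Psi> by (auto simp: G_def)
  have K: "U * \<Psi> \<in> carrier_mat m n" using U \<Psi> by auto
  obtain i k where ik: "i < p" "k < n" "G $$ (i,k) \<noteq> 0"
  proof (rule ccontr)
    assume "\<not> thesis"
    hence "\<And>i k. i < p \<Longrightarrow> k < n \<Longrightarrow> G $$ (i,k) = 0" using that by blast
    hence "G = 0\<^sub>m p n" using G by (intro eq_matI) auto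
    thus False using G0 by (simp add: G_def)
  qed
  \<comment> \<open>Since entry \<open>(i,k)\<close> of \<open>G\<close> is nonzero, moving the
    state along this unit vector changes output coordinate \<open>i\<close>.\<close>
  define g :: "real vec" where "g = unit_vec n k"
  have g: "g \<in> carrier_vec n" by (simp add: g_def)
  have Gg: "(G *\<^sub>v g) $ i = G $$ (i,k)" using G ik by (simp add: g_def)
  have "\<zeta> $ j = 0" if j: "j < d" for j
  proof -
    have "\<bar>(G *\<^sub>v col E j) $ i + s * (\<zeta> $ j * G $$ (i,k))\<bar> \<le> \<gamma> + 1" for s
    proof -
      have sg: "s \<cdot>\<^sub>v g \<in> carrier_vec n" using g by simp
      define E' where "E' = E + outer_prod (s \<cdot>\<^sub>v g) \<zeta>"
      have sys': "(A + outer_prod (s \<cdot>\<^sub>v g) \<xi>, B + outer_prod (s \<cdot>\<^sub>v g) \<eta>, E') \<in> explaining_systems U W X"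
        unfolding E'_def by (rule explaining_perturb[OF sys v sg ker])
      hence "H2_suboptimal_gain \<gamma> C D (A + outer_prod (s \<cdot>\<^sub>v g) \<xi>) (B + outer_prod (s \<cdot>\<^sub>v g) \<eta>) E' (U * \<Psi>)"
        using sub unfolding H2_suboptimal_for_data_def by blast
      hence bound: "(G *\<^sub>v col E' j) \<bullet> (G *\<^sub>v col E' j) < \<gamma>"
        using suboptimal_output_bound[OF sys' K _ _ j] closed_loop_eq(2)[OF \<Psi>]
        by (auto simp: H2_suboptimal_gain_def G_def)
      have "col E' j = col E j + (s * \<zeta> $ j) \<cdot>\<^sub>v g"
        unfolding E'_def using E g v j by (intro eq_vecI) (auto simp: outer_prod_def)
      moreover have "col E j \<in> carrier_vec n" using E j by auto
      ultimately have "(G *\<^sub>v col E' j) $ i = (G *\<^sub>v col E j) $ i + s * \<zeta> $ j * (G *\<^sub>v g) $ i"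
        using G g ik by (simp add: mult_add_distrib_mat_vec[of _ p n] mult_mat_vec[of _ p n] del: index_mult_mat_vec)
      hence "((G *\<^sub>v col E j) $ i + s * (\<zeta> $ j * G $$ (i,k)))\<^sup>2 < \<gamma>"
        using bound sq_entry_le_scalar_prod_self[of i "G *\<^sub>v col E' j"] G ik Gg by (simp add: mult.assoc)
      \<comment> \<open>The square gives
        \<open>2 * \<bar>y\<bar> \<le> y^2 + 1 < \<gamma> + 1\<close>; this bound, uniform in
        \<open>s\<close>, avoids a square root.\<close>
      moreover have "\<bar>y\<bar> \<le> \<gamma> + 1" if "y\<^sup>2 < \<gamma>" for y :: real
      proof -
        have "0 \<le> (\<bar>y\<bar> - 1)\<^sup>2" by simp
        thus ?thesis using that zero_le_power2[of y] by (simp add: power2_diff)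
      qed
      ultimately show ?thesis by blast
    qed
    hence "\<zeta> $ j * G $$ (i,k) = 0" by (rule affine_bounded_imp_zero)
    thus ?thesis using ik by simp
  qed
  thus ?thesis using v by (intro eq_vecI) auto
qed

text \<open>Both auxiliary matrices come from the solvability criterion: stability of all closed
  loops supplies the kernel condition for \<open>\<Psi>\<close>, boundedness of all costs the one
  for \<open>Wi\<close>.\<close>

lemma suboptimal_imp_cond:
  assumes sys: "(A, B, E) \<in> explaining_systems U W X" and K: "K \<in> carrier_mat m n"
    and sub: "H2_suboptimal_for_data \<gamma> C D U W X K"
  shows "\<exists>\<Theta>. (cond_i C D U W X \<Theta> \<or> (\<exists>Wi Y. cond_ii \<gamma> C D U W X Wi Y \<Theta>)) \<and> K = data_gain U X \<Theta>"
proof -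
  have st: "stable_mat (A + B * K)" and cost: "H2_cost C D A B E K < \<gamma>"
    if "(A, B, E) \<in> explaining_systems U W X" for A B E
    using sub that by (auto simp: H2_suboptimal_for_data_def H2_suboptimal_gain_def)
  \<comment> \<open>The targets \<open>1\<^sub>m n\<close>, \<open>K\<close> and zero turn the
    kernel condition into \<open>\<xi> + K\<^sup>T *\<^sub>v \<eta> = 0\<^sub>v n\<close>.\<close>
  obtain \<Psi> where \<Psi>: "\<Psi> \<in> carrier_mat T n" "Xm * \<Psi> = 1\<^sub>m n" "U * \<Psi> = K" "W * \<Psi> = 0\<^sub>m d n"
  proof (rule solvable_if_left_kernel_annihilates3[OF Xm U W one_carrier_mat K zero_carrier_mat])
    fix \<xi> \<eta> \<zeta> :: "real vec"
    assume v: "\<xi> \<in> carrier_vec n" "\<eta> \<in> carrier_vec m" "\<zeta> \<in> carrier_vec d"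
      and ker: "Xm\<^sup>T *\<^sub>v \<xi> + U\<^sup>T *\<^sub>v \<eta> + W\<^sup>T *\<^sub>v \<zeta> = 0\<^sub>v T"
    have z: "(0\<^sub>m n d :: real mat) *\<^sub>v \<zeta> = 0\<^sub>v n" using v by (intro eq_vecI) auto
    have "\<xi> + K\<^sup>T *\<^sub>v \<eta> = 0\<^sub>v n" by (rule stabilizing_imp_kernel[OF sys K st v ker])
    thus "(1\<^sub>m n)\<^sup>T *\<^sub>v \<xi> + K\<^sup>T *\<^sub>v \<eta> + (0\<^sub>m d n)\<^sup>T *\<^sub>v \<zeta> = 0\<^sub>v n" using v z by simp
  qed
  note \<Psi>' = \<Psi>(1,2,4)
  have F: "A + B * K = Xp * \<Psi>" using closed_loop_eq(1)[OF \<Psi>' sys] \<Psi>(3) by simp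
  have stF: "stable_mat (Xp * \<Psi>)" using st[OF sys] F by simp
  show ?thesis
  proof (cases "Z * \<Psi> = 0\<^sub>m p n")
    case True
    thus ?thesis using suboptimal_imp_cond_i[OF \<Psi>' stF] \<Psi>(3) by metis
  next
    case False
    \<comment> \<open>The targets zero, zero and \<open>1\<^sub>m d\<close> turn the kernel
      condition into \<open>\<zeta> = 0\<^sub>v d\<close>.\<close>
    obtain Wi where Wi: "Wi \<in> carrier_mat T d" "Xm * Wi = 0\<^sub>m n d" "U * Wi = 0\<^sub>m m d" "W * Wi = 1\<^sub>m d"
    proof (rule solvable_if_left_kernel_annihilates3[OF Xm U W zero_carrier_mat zero_carrier_mat one_carrier_mat])
      fix \<xi> \<eta> \<zeta> :: "real vec"
      assume v: "\<xi> \<in> carrier_vec n" "\<eta> \<in> carrier_vec m" "\<zeta> \<in> carrier_vec d"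
        and ker: "Xm\<^sup>T *\<^sub>v \<xi> + U\<^sup>T *\<^sub>v \<eta> + W\<^sup>T *\<^sub>v \<zeta> = 0\<^sub>v T"
      have "\<zeta> = 0\<^sub>v d"
        by (rule suboptimal_imp_disturbance_kernel[OF sys \<Psi>' _ False v ker]) (use sub \<Psi>(3) in simp)
      moreover have "(0\<^sub>m d n :: real mat) *\<^sub>v \<xi> = 0\<^sub>v d" "(0\<^sub>m d m :: real mat) *\<^sub>v \<eta> = 0\<^sub>v d"
        using v by (auto intro!: eq_vecI)
      ultimately show "(0\<^sub>m n d)\<^sup>T *\<^sub>v \<xi> + (0\<^sub>m m d)\<^sup>T *\<^sub>v \<eta> + (1\<^sub>m d)\<^sup>T *\<^sub>v \<zeta> = 0\<^sub>v d" by simp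
    qed
    show ?thesis
      using suboptimal_imp_cond_ii[OF sys \<Psi>' stF Wi, of \<gamma>] cost[OF sys] \<Psi>(3) by metis
  qed
qed

section \<open>Sufficiency: from the conditions to a suboptimal gain\<close>

text \<open>With \<open>R\<close> the inverse of \<open>Xm * \<Theta>\<close> and
  \<open>\<Psi> = \<Theta> * R\<close>, every explaining system has closed loop \<open>F\<close> and
  output matrix \<open>G\<close>, and \<open>R\<close> defines a Lyapunov function for
  \<open>F\<close>. Under (ii), \<open>Y\<close> dominates \<open>E\<^sup>T * R * E\<close>, which
  bounds the output energy.\<close>

lemma cond_imp_suboptimal:
  assumes \<gamma>: "\<gamma> > 0"
    and cond: "cond_i C D U W X \<Theta> \<or> (\<exists>Wi Y. cond_ii \<gamma> C D U W X Wi Y \<Theta>)"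
  shows "data_gain U X \<Theta> \<in> carrier_mat m n" "H2_suboptimal_for_data \<gamma> C D U W X (data_gain U X \<Theta>)"
proof -
  have \<Theta>: "\<Theta> \<in> carrier_mat T n" using cond X Xm by (auto simp: cond_i_def cond_ii_def Let_def)
  define Q where "Q = Xm * \<Theta>"
  have Q: "Q \<in> carrier_mat n n" using Xm \<Theta> by (auto simp: Q_def)
  have XpT: "Xp * \<Theta> \<in> carrier_mat n n" and ZT: "Z * \<Theta> \<in> carrier_mat p n" using Xp Z \<Theta> by auto
  have Wi_carrier: "Wi \<in> carrier_mat T d" if "cond_ii \<gamma> C D U W X Wi Y \<Theta>" for Wi Y
    using that W by (auto simp: cond_ii_def Let_def right_inverse_mat_def)
  have sym: "Q\<^sup>T = Q" and WT: "W * \<Theta> = 0\<^sub>m d n"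
    using cond cond_i_iff[OF \<Theta>] cond_ii_iff[OF \<Theta> Wi_carrier] by (auto simp: Q_def)
  \<comment> \<open>Under either condition \<open>Q\<close> is the lower right block of a positive
    definite four-block matrix; under (ii) it is the one containing \<open>Y\<close>.\<close>
  have pd: "pos_def_mat Q"
    using cond
  proof (elim disjE exE)
    assume "cond_i C D U W X \<Theta>"
    hence "pos_def_mat (four_block_mat Q (Xp * \<Theta>)\<^sup>T (Xp * \<Theta>) Q)" unfolding cond_i_iff[OF \<Theta>] Q_def by simp
    thus ?thesis by (rule pos_def_lower_block[OF Q XpT Q sym])
  next
    fix Wi Y assume c: "cond_ii \<gamma> C D U W X Wi Y \<Theta>"
    note Wi = Wi_carrier[OF c]
    have Y: "Y \<in> carrier_mat d d" and "pos_def_mat (four_block_mat Y (Xp * Wi)\<^sup>T (Xp * Wi) Q)"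
      using c unfolding cond_ii_iff[OF \<Theta> Wi] Q_def by auto
    moreover have "Xp * Wi \<in> carrier_mat n d" using Xp Wi by auto
    ultimately show ?thesis using pos_def_lower_block[OF Y _ Q sym] by blast
  qed
  obtain R where R: "R \<in> carrier_mat n n" "Q * R = 1\<^sub>m n" "R * Q = 1\<^sub>m n" "pos_def_mat R"
    using pos_def_inverse[OF pd Q] by metis
  define \<Psi> where "\<Psi> = \<Theta> * R"
  have \<Psi>: "\<Psi> \<in> carrier_mat T n" using \<Theta> R by (auto simp: \<Psi>_def)
  have XPsi: "Xm * \<Psi> = 1\<^sub>m n" unfolding \<Psi>_def using assoc_mult_mat[OF Xm \<Theta> R(1)] R(2) by (simp add: Q_def)
  have WPsi: "W * \<Psi> = 0\<^sub>m d n" unfolding \<Psi>_def using assoc_mult_mat[OF W \<Theta> R(1)] WT R(1) by simp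
  have \<Psi>Q: "\<Psi> * Q = \<Theta>" unfolding \<Psi>_def using assoc_mult_mat[OF \<Theta> R(1) Q] R(3) \<Theta> by simp
  have K: "data_gain U X \<Theta> = U * \<Psi>"
    unfolding \<Psi>_def using data_gain_eq[OF \<Theta> pd[unfolded Q_def] R(1) R(2)[unfolded Q_def]] .
  have Kc: "U * \<Psi> \<in> carrier_mat m n" using U \<Psi> by auto
  thus "data_gain U X \<Theta> \<in> carrier_mat m n" by (simp add: K)
  define F where "F = Xp * \<Psi>"
  define G where "G = Z * \<Psi>"
  have F: "F \<in> carrier_mat n n" using Xp \<Psi> by (auto simp: F_def)
  have G: "G \<in> carrier_mat p n" using Z \<Psi> by (auto simp: G_def)
  have FQ: "F * Q = Xp * \<Theta>" unfolding F_def using assoc_mult_mat[OF Xp \<Psi> Q] \<Psi>Q by simp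
  have GQ: "G * Q = Z * \<Theta>" unfolding G_def using assoc_mult_mat[OF Z \<Psi> Q] \<Psi>Q by simp
  note cl = closed_loop_eq[OF \<Psi> XPsi WPsi, folded F_def G_def]
  have sub: "stable_mat F \<and> H2_cost C D A B E (U * \<Psi>) < \<gamma>" if sys: "(A, B, E) \<in> explaining_systems U W X" for A B E
  proof -
    have A: "A \<in> carrier_mat n n" and B: "B \<in> carrier_mat n m" and E: "E \<in> carrier_mat n d"
      using sys by (auto simp: explaining_iff)
    note cost = H2_cost_def[of C D A B E "U * \<Psi>", unfolded trace_closed_loop_response[OF C D Kc A B E] cl(1)[OF sys] cl(2)]
    have e: "col E j \<in> carrier_vec n" if "j < d" for j using E that by auto
    from cond show ?thesis
    proof (elim disjE exE)
      assume c: "cond_i C D U W X \<Theta>"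
      hence "pos_def_mat (four_block_mat Q (F * Q)\<^sup>T (F * Q) Q)" and ZT0: "Z * \<Theta> = 0\<^sub>m p n"
        unfolding cond_i_iff[OF \<Theta>] FQ by (auto simp: Q_def)
      hence st: "stable_mat F"
        using stable_mat_if_lyapunov[OF F R(1,4)] pos_def_lyapunov_block_iff[OF Q pd R(1-3) F] by blast
      have "G = 0\<^sub>m p n" unfolding G_def \<Psi>_def using assoc_mult_mat[OF Z \<Theta> R(1)] ZT0 R(1) by simp
      moreover have "F ^\<^sub>m t *\<^sub>v v \<in> carrier_vec n" if "v \<in> carrier_vec n" for t v
        using pow_carrier_mat[OF F] that by (rule mult_mat_vec_carrier)
      moreover have "(0\<^sub>m p n :: real mat) *\<^sub>v v = 0\<^sub>v p" if "v \<in> carrier_vec n" for v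
        using that by (intro eq_vecI) auto
      \<comment> \<open>The output vanishes identically, so the cost is 0 and the bound is
        \<open>\<gamma> > 0\<close>.\<close>
      ultimately have "H2_cost C D A B E (U * \<Psi>) = 0" unfolding cost using e by simp
      thus ?thesis using st \<gamma> by simp
    next
      fix Wi Y assume c: "cond_ii \<gamma> C D U W X Wi Y \<Theta>"
      note Wi = Wi_carrier[OF c]
      have Y: "Y \<in> carrier_mat d d" "Y\<^sup>T = Y" and tr: "mat_trace Y < \<gamma>"
        and three: "pos_def_mat (three_block_mat Q (F * Q)\<^sup>T (G * Q)\<^sup>T (F * Q) Q (0\<^sub>m n p) (G * Q) (0\<^sub>m p n) (1\<^sub>m p))"
        and four: "pos_def_mat (four_block_mat Y (Xp * Wi)\<^sup>T (Xp * Wi) Q)"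
        and Wi0: "Xm * Wi = 0\<^sub>m n d" "U * Wi = 0\<^sub>m m d" "W * Wi = 1\<^sub>m d"
        using c unfolding cond_ii_iff[OF \<Theta> Wi] FQ GQ by (auto simp: Q_def)
      have XpWi: "Xp * Wi = E" by (rule future_mult_right_inverse[OF sys Wi Wi0])
      have dec: "(F *\<^sub>v a) \<bullet> (R *\<^sub>v (F *\<^sub>v a)) + (G *\<^sub>v a) \<bullet> (G *\<^sub>v a) < a \<bullet> (R *\<^sub>v a)"
        if "a \<in> carrier_vec n" "a \<noteq> 0\<^sub>v n" for a
        using three that unfolding pos_def_three_block_iff[OF Q pd R(1-3) F G] by blast
      have st: "stable_mat F"
      proof (rule stable_mat_if_lyapunov[OF F R(1,4)])
        fix a :: "real vec" assume a: "a \<in> carrier_vec n" "a \<noteq> 0\<^sub>v n"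
        have "0 \<le> (G *\<^sub>v a) \<bullet> (G *\<^sub>v a)" by (simp add: scalar_prod_def sum_nonneg)
        thus "(F *\<^sub>v a) \<bullet> (R *\<^sub>v (F *\<^sub>v a)) < a \<bullet> (R *\<^sub>v a)" using dec[OF a] by linarith
      qed
      have nonneg: "0 \<le> a \<bullet> (R *\<^sub>v a)" if "a \<in> carrier_vec n" for a by (rule pos_def_matD(3)[OF R(4,1) that])
      \<comment> \<open>The zero vector is included with equality, since columns of \<open>E\<close>
        and later points of their trajectories may vanish.\<close>
      have dec': "(F *\<^sub>v a) \<bullet> (R *\<^sub>v (F *\<^sub>v a)) + (G *\<^sub>v a) \<bullet> (G *\<^sub>v a) \<le> a \<bullet> (R *\<^sub>v a)"
        if "a \<in> carrier_vec n" for a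
        using dec[OF that] that mult_mat_vec_zero[OF F] mult_mat_vec_zero[OF G] R(1)
        by (cases "a = 0\<^sub>v n") (auto intro: less_imp_le)
      define f where "f t = (\<Sum>j<d. (G *\<^sub>v (F ^\<^sub>m t *\<^sub>v col E j)) \<bullet> (G *\<^sub>v (F ^\<^sub>m t *\<^sub>v col E j)))" for t
      \<comment> \<open>A bound uniform in \<open>N\<close> gives both convergence and a bound on
        the series; strictness then comes from \<open>mat_trace Y < \<gamma>\<close>.\<close>
      have partial: "(\<Sum>t<N. f t) \<le> mat_trace Y" for N
      proof -
        have "(\<Sum>t<N. f t) = (\<Sum>j<d. \<Sum>t<N. (G *\<^sub>v (F ^\<^sub>m t *\<^sub>v col E j)) \<bullet> (G *\<^sub>v (F ^\<^sub>m t *\<^sub>v col E j)))"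
          unfolding f_def by (rule sum.swap)
        also have "\<dots> \<le> (\<Sum>j<d. Y $$ (j,j))"
        proof (rule sum_mono)
          fix j assume "j \<in> {..<d}"
          hence j: "j < d" by simp
          have "(\<Sum>t<N. (G *\<^sub>v (F ^\<^sub>m t *\<^sub>v col E j)) \<bullet> (G *\<^sub>v (F ^\<^sub>m t *\<^sub>v col E j))) \<le> col E j \<bullet> (R *\<^sub>v col E j)"
            by (rule sum_output_energy_le[OF F nonneg dec' e[OF j]])
          also have "E *\<^sub>v unit_vec d j = col E j" using E j by (intro eq_vecI) auto
          \<comment> \<open>The Schur inequality at the \<open>j\<close>-th unit vector compares the
            diagonal entries \<open>j\<close> of \<open>E\<^sup>T * R * E\<close> and
            \<open>Y\<close>.\<close>
          hence "col E j \<bullet> (R *\<^sub>v col E j) < unit_vec d j \<bullet> (Y *\<^sub>v unit_vec d j)"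
            using four j unfolding XpWi pos_def_block_iff[OF Y E Q pd R(1,2)]
            by (auto dest!: bspec[of _ _ "unit_vec d j"])
          also have "unit_vec d j \<bullet> (Y *\<^sub>v unit_vec d j) = Y $$ (j,j)" using Y j by simp
          finally show "(\<Sum>t<N. (G *\<^sub>v (F ^\<^sub>m t *\<^sub>v col E j)) \<bullet> (G *\<^sub>v (F ^\<^sub>m t *\<^sub>v col E j))) \<le> Y $$ (j,j)" by simp
        qed
        also have "\<dots> = mat_trace Y" using Y by (simp add: mat_trace_def)
        finally show ?thesis .
      qed
      have "f t \<ge> 0" for t unfolding f_def by (intro sum_nonneg) (simp add: scalar_prod_def sum_nonneg)
      hence "summable f" by (rule summableI_nonneg_bounded[OF _ partial])
      hence "suminf f \<le> mat_trace Y" using partial by (rule suminf_le_const)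
      thus ?thesis using st tr unfolding cost f_def by simp
    qed
  qed
  show "H2_suboptimal_for_data \<gamma> C D U W X (data_gain U X \<Theta>)"
    unfolding H2_suboptimal_for_data_def H2_suboptimal_gain_def K
    using sub cl(1) Kc by (auto simp: explaining_iff)
qed

end

section \<open>The characterisation for measured trajectories\<close>

theorem corollary15:
  fixes n m d p T :: nat
    and A\<^sub>s B\<^sub>s E\<^sub>s C D U W X :: "real mat"
    and x u w :: "nat \<Rightarrow> real vec"
    and \<gamma> :: real
  assumes As: "A\<^sub>s \<in> carrier_mat n n"
    and Bs: "B\<^sub>s \<in> carrier_mat n m"
    and Es: "E\<^sub>s \<in> carrier_mat n d"
    and C: "C \<in> carrier_mat p n"
    and D: "D \<in> carrier_mat p m"
    and x: "\<And>t. t \<le> T \<Longrightarrow> x t \<in> carrier_vec n"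
    and u: "\<And>t. t < T \<Longrightarrow> u t \<in> carrier_vec m"
    and w: "\<And>t. t < T \<Longrightarrow> w t \<in> carrier_vec d"
    and system: "\<And>t. t < T \<Longrightarrow> x (t + 1) = A\<^sub>s *\<^sub>v x t + B\<^sub>s *\<^sub>v u t + E\<^sub>s *\<^sub>v w t"
    and U: "U = mat_of_cols m (map u [0..<T])"
    and W: "W = mat_of_cols d (map w [0..<T])"
    and X: "X = mat_of_cols n (map x [0..<T + 1])"
    and gamma: "\<gamma> > 0"
  shows "(informative_H2 \<gamma> C D U W X \<longleftrightarrow>
            (\<exists>\<Theta>. cond_i C D U W X \<Theta>) \<or> (\<exists>Wi Y \<Theta>. cond_ii \<gamma> C D U W X Wi Y \<Theta>)) \<and>
         (\<forall>K \<in> carrier_mat m n.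
            H2_suboptimal_for_data \<gamma> C D U W X K \<longleftrightarrow>
            (\<exists>\<Theta>. (cond_i C D U W X \<Theta> \<or> (\<exists>Wi Y. cond_ii \<gamma> C D U W X Wi Y \<Theta>)) \<and>
                 K = data_gain U X \<Theta>))"
proof -
  note data = U W X
  interpret data_driven n m d p T C D U W X
    by unfold_locales (use C D in \<open>auto simp: data\<close>)
  have "Xp = A\<^sub>s * Xm + B\<^sub>s * U + E\<^sub>s * W"
  proof (rule mat_col_eqI)
    fix t assume "t < dim_col (A\<^sub>s * Xm + B\<^sub>s * U + E\<^sub>s * W)"
    hence t: "t < T" using W by simp
    have Xm_col: "col Xm t = x t"
      using t x[of t] by (intro eq_vecI) (auto simp: past_cols_def data mat_of_cols_index simp del: upt_Suc)
    have Xp_col: "col Xp t = x (t + 1)"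
      using t x[of "t + 1"] by (intro eq_vecI) (auto simp: future_cols_def data mat_of_cols_index simp del: upt_Suc)
    have "col U t = u t" "col W t = w t" using t u w by (auto simp: data intro!: col_mat_of_cols)
    hence "col (A\<^sub>s * Xm + B\<^sub>s * U + E\<^sub>s * W) t = A\<^sub>s *\<^sub>v x t + B\<^sub>s *\<^sub>v u t + E\<^sub>s *\<^sub>v w t"
      using Xm_col col_mult2[OF As Xm t] col_mult2[OF Bs U t] col_mult2[OF Es W t]
        mult_carrier_mat[OF As Xm] mult_carrier_mat[OF Bs U] mult_carrier_mat[OF Es W] t
        mult_mat_vec_carrier[OF As x] mult_mat_vec_carrier[OF Bs u] mult_mat_vec_carrier[OF Es w]
      by (simp add: col_add[of _ n T] assoc_add_vec[of _ n])
    thus "col Xp t = col (A\<^sub>s * Xm + B\<^sub>s * U + E\<^sub>s * W) t" using system[OF t] Xp_col by simp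
  qed (use As Bs Es Xp in \<open>auto simp: data\<close>)
  \<comment> \<open>The true system makes the set of explaining systems nonempty; over an empty set
    suboptimality for the data would hold vacuously for every gain.\<close>
  hence sys: "(A\<^sub>s, B\<^sub>s, E\<^sub>s) \<in> explaining_systems U W X" using As Bs Es by (simp add: explaining_iff)
  have gain: "H2_suboptimal_for_data \<gamma> C D U W X K \<longleftrightarrow>
      (\<exists>\<Theta>. (cond_i C D U W X \<Theta> \<or> (\<exists>Wi Y. cond_ii \<gamma> C D U W X Wi Y \<Theta>)) \<and> K = data_gain U X \<Theta>)"
    if "K \<in> carrier_mat m n" for K
    using suboptimal_imp_cond[OF sys that] cond_imp_suboptimal(2)[OF gamma] by blast
  have dims: "dim_row U = m" "dim_row X = n" by (auto simp: data)
  \<comment> \<open>A \<open>\<Theta>\<close> satisfying (i) or (ii) supplies the common gain as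
    \<open>data_gain U X \<Theta>\<close>, which has the required dimensions.\<close>
  have "informative_H2 \<gamma> C D U W X \<longleftrightarrow> (\<exists>\<Theta>. cond_i C D U W X \<Theta> \<or> (\<exists>Wi Y. cond_ii \<gamma> C D U W X Wi Y \<Theta>))"
    unfolding informative_H2_def dims using gain cond_imp_suboptimal(1)[OF gamma] by blast
  thus ?thesis using gain by blast
qed

end
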